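(* Let $A$ and $B$ be finite-dimensional $k$-algebras, with fixed vector space decompositions $A=k\cdot 1\oplus\overline{A}$ and $B=k\cdot 1\oplus\overline{B}$. Consider the free product $A*B$ and put $m=\min(\dim_kA,\dim_kB)$. Let $V\subset\overline{A}\oplus\overline{B}\subset A*B$ be a subspace that is generic with respect to $\overline{A}$ and $\overline{B}$. Then $\mathrm{mid}\big((V,A*B)^{ab}\big)\le m$, i.e. $(V,A*B)^{ab}$ is a $MID_m$-algebra.
   Context: $k$ is an algebraically closed field of characteristic zero; all algebras are unital and associative. $A*B$ is the free product of the unital $k$-algebras $A$ and $B$. A subspace $V\subset\overline{A}\oplus\overline{B}$ is called generic with respect to $\overline{A}$ and $\overline{B}$ if the restrictions to $V$ of the natural projections $\overline{A}\oplus\overline{B}\to\overline{A}$ and $\overline{A}\oplus\overline{B}\to\overline{B}$ are both surjective. $R(V)\subset A*B$ is the subalgebra generated by $V$, and the partial abelianization $(V,A*B)^{ab}=(R(V),A*B)^{ab}$ is the quotient of $A*B$ by the two-sided ideal generated by the commutator space $[R(V),R(V)]$. For an algebra $R$, $\mathrm{mid}(R)$ denotes the maximal dimension of irreducible representations of $R$ (the value $\infty$ is allowed); $R$ is called a $MID_r$-algebra if $\mathrm{mid}(R)\le r$. *)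

theory Defs
  imports
    "HOL-Algebra.QuotRing"
    "HOL-Algebra.Subrings"
    "HOL-Library.Extended_Nat"
    "HOL-Computational_Algebra.Polynomial"
    "Jordan_Normal_Form.VS_Connect"
begin

section \<open>Unital associative algebras\<close>

text \<open>
  The ground field is the type \<open>'k\<close>, viewed as the ring record \<^term>\<open>class_ring\<close>. An algebra is a
  \<^typ>\<open>('k, 'a) module\<close> record, which carries both a multiplication and a scalar multiplication.
  The library locale \<open>algebra\<close> requires commutativity, hence the following one. The zero algebra is
  not excluded.
\<close>

locale unital_algebra =
  ring A + vs: vectorspace class_ring A
  for A :: "('k :: field, 'a) module" (structure) +
  assumes smult_mult_left: "\<lbrakk>x \<in> carrier A; y \<in> carrier A\<rbrakk> \<Longrightarrow> c \<odot> (x \<otimes> y) = (c \<odot> x) \<otimes> y"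
    and smult_mult_right: "\<lbrakk>x \<in> carrier A; y \<in> carrier A\<rbrakk> \<Longrightarrow> c \<odot> (x \<otimes> y) = x \<otimes> (c \<odot> y)"

definition subalgebra_of :: "'a set \<Rightarrow> ('k :: field, 'a) module \<Rightarrow> bool" where
  "subalgebra_of T A \<longleftrightarrow> subring T A \<and> VectorSpace.subspace class_ring T A"

definition generated_subalgebra :: "('k :: field, 'a) module \<Rightarrow> 'a set \<Rightarrow> 'a set" where
  "generated_subalgebra A S = \<Inter> {T. subalgebra_of T A \<and> S \<subseteq> T}"

text \<open>
  In a unital algebra every two-sided ring ideal is stable under scalars, so the ring quotient
  is an algebra with the following scalar multiplication of cosets.
\<close>

definition quotient_algebra :: "('k :: field, 'a) module \<Rightarrow> 'a set \<Rightarrow> ('k, 'a set) module" where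
  "quotient_algebra A I =
     ring.extend (A Quot I) (module.fields (\<lambda>c X. \<Union>x\<in>X. I +>\<^bsub>A\<^esub> (c \<odot>\<^bsub>A\<^esub> x)))"

text \<open>The condition \<open>A = k \<cdot> 1 \<oplus> U\<close> as vector spaces.\<close>

definition unit_complement :: "('k :: field, 'a) module \<Rightarrow> 'a set \<Rightarrow> bool" where
  "unit_complement A U \<longleftrightarrow>
     VectorSpace.subspace class_ring U A \<and>
     range (\<lambda>c. c \<odot>\<^bsub>A\<^esub> \<one>\<^bsub>A\<^esub>) \<inter> U = {\<zero>\<^bsub>A\<^esub>} \<and>
     module.submodule_sum A (range (\<lambda>c. c \<odot>\<^bsub>A\<^esub> \<one>\<^bsub>A\<^esub>)) U = carrier A"


section \<open>The free product\<close>

text \<open>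
  The free algebra on the set \<open>X\<close>: finitely supported functions on the words over \<open>X\<close>, with the
  convolution product induced by concatenation of words.
\<close>

definition free_algebra :: "'x set \<Rightarrow> ('k :: field, 'x list \<Rightarrow> 'k) module" where
  "free_algebra X =
     \<lparr>carrier = {f. finite {w. f w \<noteq> 0} \<and> {w. f w \<noteq> 0} \<subseteq> lists X},
      mult = (\<lambda>f g w. \<Sum>i\<le>length w. f (take i w) * g (drop i w)),
      one = (\<lambda>w. if w = [] then 1 else 0),
      zero = (\<lambda>w. 0),
      add = (\<lambda>f g w. f w + g w),
      smult = (\<lambda>c f w. c * f w)\<rparr>"

definition free_gen :: "'x \<Rightarrow> 'x list \<Rightarrow> 'k :: field" where
  "free_gen x = (\<lambda>w. if w = [x] then 1 else 0)"

text \<open>The elements of \<open>F\<close> that must vanish for \<open>g\<close> to be a unital algebra homomorphism \<open>A \<rightarrow> F\<close>.\<close>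

definition hom_relations ::
    "('k :: field, 'a) module \<Rightarrow> ('k, 'f) module \<Rightarrow> ('a \<Rightarrow> 'f) \<Rightarrow> 'f set" where
  "hom_relations A F g =
     {g (x \<oplus>\<^bsub>A\<^esub> y) \<ominus>\<^bsub>F\<^esub> (g x \<oplus>\<^bsub>F\<^esub> g y) | x y. x \<in> carrier A \<and> y \<in> carrier A} \<union>
     {g (c \<odot>\<^bsub>A\<^esub> x) \<ominus>\<^bsub>F\<^esub> (c \<odot>\<^bsub>F\<^esub> g x) | c x. x \<in> carrier A} \<union>
     {g (x \<otimes>\<^bsub>A\<^esub> y) \<ominus>\<^bsub>F\<^esub> (g x \<otimes>\<^bsub>F\<^esub> g y) | x y. x \<in> carrier A \<and> y \<in> carrier A} \<union>
     {g \<one>\<^bsub>A\<^esub> \<ominus>\<^bsub>F\<^esub> \<one>\<^bsub>F\<^esub>}"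

abbreviation free_algebra_on ::
    "('k :: field, 'a) module \<Rightarrow> ('k, 'b) module \<Rightarrow> ('k, ('a + 'b) list \<Rightarrow> 'k) module" where
  "free_algebra_on A B \<equiv> free_algebra (Sum_Type.Plus (carrier A) (carrier B))"

definition free_product_ideal ::
    "('k :: field, 'a) module \<Rightarrow> ('k, 'b) module \<Rightarrow> (('a + 'b) list \<Rightarrow> 'k) set" where
  "free_product_ideal A B =
     (let F = free_algebra_on A B
      in Idl\<^bsub>F\<^esub> (hom_relations A F (\<lambda>a. free_gen (Inl a)) \<union>
                hom_relations B F (\<lambda>b. free_gen (Inr b))))"

definition free_product ::
    "('k :: field, 'a) module \<Rightarrow> ('k, 'b) module \<Rightarrow> ('k, (('a + 'b) list \<Rightarrow> 'k) set) module" where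
  "free_product A B =
     quotient_algebra (free_algebra_on A B) (free_product_ideal A B)"

definition free_product_inl ::
    "('k :: field, 'a) module \<Rightarrow> ('k, 'b) module \<Rightarrow> 'a \<Rightarrow> (('a + 'b) list \<Rightarrow> 'k) set" where
  "free_product_inl A B a =
     free_product_ideal A B +>\<^bsub>free_algebra_on A B\<^esub> free_gen (Inl a)"

definition free_product_inr ::
    "('k :: field, 'a) module \<Rightarrow> ('k, 'b) module \<Rightarrow> 'b \<Rightarrow> (('a + 'b) list \<Rightarrow> 'k) set" where
  "free_product_inr A B b =
     free_product_ideal A B +>\<^bsub>free_algebra_on A B\<^esub> free_gen (Inr b)"

text \<open>
  A subspace of the sum of the complements \<open>Abar\<close> and \<open>Bbar\<close> is given as a set of pairs, a subspace
  of the external direct sum; the following map places it in the free product.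
\<close>

definition sum_embed ::
    "('k :: field, 'a) module \<Rightarrow> ('k, 'b) module \<Rightarrow> 'a \<times> 'b \<Rightarrow> (('a + 'b) list \<Rightarrow> 'k) set" where
  "sum_embed A B p =
     free_product_inl A B (fst p) \<oplus>\<^bsub>free_product A B\<^esub> free_product_inr A B (snd p)"

definition generic_subspace ::
    "('k :: field, 'a) module \<Rightarrow> ('k, 'b) module \<Rightarrow> 'a set \<Rightarrow> 'b set \<Rightarrow> ('a \<times> 'b) set \<Rightarrow> bool" where
  "generic_subspace A B Abar Bbar V \<longleftrightarrow>
     VectorSpace.subspace class_ring V
       (direct_sum (A\<lparr>carrier := Abar\<rparr>) (B\<lparr>carrier := Bbar\<rparr>)) \<and>
     fst ` V = Abar \<and> snd ` V = Bbar"


section \<open>Partial abelianization\<close>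

definition commutator_space :: "('k :: field, 'a) module \<Rightarrow> 'a set \<Rightarrow> 'a set" where
  "commutator_space S R =
     LinearCombinations.module.span class_ring S
       {x \<otimes>\<^bsub>S\<^esub> y \<ominus>\<^bsub>S\<^esub> y \<otimes>\<^bsub>S\<^esub> x | x y. x \<in> R \<and> y \<in> R}"

definition partial_abelianization ::
    "('k :: field, 'a) module \<Rightarrow> 'a set \<Rightarrow> ('k, 'a set) module" where
  "partial_abelianization S V =
     quotient_algebra S (Idl\<^bsub>S\<^esub> (commutator_space S (generated_subalgebra S V)))"


section \<open>Irreducible representations\<close>

definition representation ::
    "('k :: field, 'a) module \<Rightarrow> ('k, 'w) module \<Rightarrow> ('a \<Rightarrow> 'w \<Rightarrow> 'w) \<Rightarrow> bool" where
  "representation R W \<rho> \<longleftrightarrow>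
     vectorspace class_ring W \<and>
     (\<forall>x\<in>carrier R. \<rho> x \<in> module_hom class_ring W W) \<and>
     (\<forall>w\<in>carrier W. \<rho> \<one>\<^bsub>R\<^esub> w = w) \<and>
     (\<forall>x\<in>carrier R. \<forall>y\<in>carrier R. \<forall>w\<in>carrier W. \<rho> (x \<otimes>\<^bsub>R\<^esub> y) w = \<rho> x (\<rho> y w)) \<and>
     (\<forall>x\<in>carrier R. \<forall>y\<in>carrier R. \<forall>w\<in>carrier W. \<rho> (x \<oplus>\<^bsub>R\<^esub> y) w = \<rho> x w \<oplus>\<^bsub>W\<^esub> \<rho> y w) \<and>
     (\<forall>c. \<forall>x\<in>carrier R. \<forall>w\<in>carrier W. \<rho> (c \<odot>\<^bsub>R\<^esub> x) w = c \<odot>\<^bsub>W\<^esub> \<rho> x w)"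

definition irreducible_representation ::
    "('k :: field, 'a) module \<Rightarrow> ('k, 'w) module \<Rightarrow> ('a \<Rightarrow> 'w \<Rightarrow> 'w) \<Rightarrow> bool" where
  "irreducible_representation R W \<rho> \<longleftrightarrow>
     representation R W \<rho> \<and> carrier W \<noteq> {\<zero>\<^bsub>W\<^esub>} \<and>
     (\<forall>U. VectorSpace.subspace class_ring U W \<and> (\<forall>x\<in>carrier R. \<rho> x ` U \<subseteq> U) \<longrightarrow>
          U = {\<zero>\<^bsub>W\<^esub>} \<or> U = carrier W)"

definition edim :: "('k :: field, 'w) module \<Rightarrow> enat" where
  "edim W = (if vectorspace.fin_dim class_ring W then enat (vectorspace.dim class_ring W) else \<infinity>)"

text \<open>
  The supremum runs over all irreducible representations, infinite-dimensional ones included, on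
  vector spaces with carrier in the type \<open>'w\<close>. Every irreducible representation of \<open>R\<close> is isomorphic
  to a quotient of the regular one, so \<open>'a set\<close> is a large enough choice of \<open>'w\<close>; for a small \<open>'w\<close>
  the value may be too small, so upper bounds must be stated for arbitrary \<open>'w\<close>.
\<close>

definition mid :: "'w itself \<Rightarrow> ('k :: field, 'a) module \<Rightarrow> enat" where
  "mid _ R = Sup {edim W | (W :: ('k, 'w) module) \<rho>. irreducible_representation R W \<rho>}"

definition MID_algebra :: "'w itself \<Rightarrow> nat \<Rightarrow> ('k :: field, 'a) module \<Rightarrow> bool" where
  "MID_algebra u r R \<longleftrightarrow> mid u R \<le> enat r"

end

theory Submission
  imports Defs
begin

text \<open>
  Let \<open>W\<close> be an irreducible module over the partial abelianization and let \<open>C\<close> be the commutative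
  subalgebra generated by finitely many sums \<open>q = a + b\<close> from \<open>V\<close> that suffice to span \<open>A\<close> and \<open>B\<close> modulo
  scalars. Since \<open>a' q = (q' - b') q = q' q - b' a - b' b\<close> and \<open>b' = q' - a'\<close>, the products \<open>c a\<close> span the whole
  algebra, so \<open>W = C A w\<close> is finitely generated over \<open>C\<close> and has a maximal proper \<open>C\<close>-stable subspace. By
  the Nullstellensatz its quotient gives a nonzero functional \<open>\<phi>\<close> on \<open>W\<close> with \<open>\<phi> (c w) = \<chi> c * \<phi> w\<close>
  for a character \<open>\<chi>\<close> of \<open>C\<close>. From \<open>\<phi> (b w) = \<chi> q * \<phi> w - \<phi> (a w)\<close>, the vectors annihilated by
  \<open>\<phi> \<circ> A\<close> are those annihilated by \<open>\<phi> \<circ> B\<close>, hence form a proper submodule, which is zero.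
  So \<open>w\<close> is determined by the values of \<open>\<phi>\<close> on \<open>e w\<close> for \<open>e\<close> in a basis of \<open>A\<close>, or equally of \<open>B\<close>.
\<close>

section \<open>Extension of characters and the weak Nullstellensatz\<close>

text \<open>A module that is finitely generated over \<open>C\<close> does have a maximal proper
  submodule, and this supplies an eigenvector in the dual instead. Keeping only finitely many sums
  makes \<open>C\<close> a finitely generated algebra, as the Nullstellensatz over a possibly
  countable field requires. The vectors \<open>v\<close> with \<open>\<phi> (a v) = 0\<close> for
  all \<open>a\<close> in \<open>A\<close> are stable under \<open>A\<close>, because
  \<open>A\<close> is closed under products. The second description, by \<open>B\<close>, makes them
  stable under \<open>B\<close> in the same way, and \<open>A\<close> and \<open>B\<close> generate
  everything. Properness comes from the unit: such \<open>v\<close> satisfy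
  \<open>\<phi> v = 0\<close>, while \<open>\<phi>\<close> is not zero. The two descriptions give
  the bounds \<open>dim A\<close> and \<open>dim B\<close>, hence the minimum. The Nullstellensatz
  is proved for domains, in the stronger form that points with values in the field can avoid any
  prescribed nonzero element; this form survives the adjunction of one more generator. So the ideal
  of \<open>C\<close> that the argument produces only has to be shown prime.\<close>

lemma ring_hom_factor:
  assumes "ring P" "ring K" "ring S" and f: "f \<in> Ring.ring_hom P K" and g: "g \<in> Ring.ring_hom P S"
    and ker: "\<And>x. x \<in> carrier P \<Longrightarrow> f x = \<zero>\<^bsub>K\<^esub> \<Longrightarrow> g x = \<zero>\<^bsub>S\<^esub>"
  shows "\<exists>\<chi>\<in>Ring.ring_hom (K\<lparr>carrier := f ` carrier P\<rparr>) S. \<forall>x\<in>carrier P. \<chi> (f x) = g x"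
proof -
  interpret P: ring P by fact
  interpret K: ring K by fact
  interpret S: ring S by fact
  interpret f: ring_hom_ring P K f by (rule ring_hom_ringI2[OF assms(1,2) f])
  interpret g: ring_hom_ring P S g by (rule ring_hom_ringI2[OF assms(1,3) g])
  \<comment> \<open>The preimage under \<open>f\<close> is picked arbitrarily. Two preimages differ
    by an element of the kernel of \<open>f\<close>, which \<open>g\<close> kills, so the choice
    does not matter.\<close>
  define \<chi> where "\<chi> y = g (SOME x. x \<in> carrier P \<and> f x = y)" for y
  have \<chi>: "\<chi> (f x) = g x" if x: "x \<in> carrier P" for x
  proof -
    define z where "z = (SOME z. z \<in> carrier P \<and> f z = f x)"
    have z: "z \<in> carrier P" "f z = f x"
      using someI[of "\<lambda>z. z \<in> carrier P \<and> f z = f x" x] x by (auto simp: z_def)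
    have "f (z \<ominus>\<^bsub>P\<^esub> x) = \<zero>\<^bsub>K\<^esub>"
      using x z by (simp add: P.minus_eq K.r_neg)
    then have "g (z \<ominus>\<^bsub>P\<^esub> x) = \<zero>\<^bsub>S\<^esub>"
      using x z ker by blast
    then have "g z \<ominus>\<^bsub>S\<^esub> g x = \<zero>\<^bsub>S\<^esub>"
      using x z by (simp add: P.minus_eq S.minus_eq)
    then have "g z = g x"
      using x z by simp
    then show ?thesis by (simp add: \<chi>_def z_def)
  qed
  have "\<chi> \<in> Ring.ring_hom (K\<lparr>carrier := f ` carrier P\<rparr>) S"
  proof (rule ring_hom_memI)
    fix a b assume "a \<in> carrier (K\<lparr>carrier := f ` carrier P\<rparr>)" "b \<in> carrier (K\<lparr>carrier := f ` carrier P\<rparr>)"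
    then obtain x y where xy: "x \<in> carrier P" "y \<in> carrier P" "a = f x" "b = f y" by auto
    show "\<chi> a \<in> carrier S" using xy \<chi> by simp
    have "\<chi> (f (x \<otimes>\<^bsub>P\<^esub> y)) = \<chi> (f x) \<otimes>\<^bsub>S\<^esub> \<chi> (f y)" using xy(1,2) \<chi> P.m_closed by (metis g.hom_mult)
    then show "\<chi> (a \<otimes>\<^bsub>K\<lparr>carrier := f ` carrier P\<rparr>\<^esub> b) = \<chi> a \<otimes>\<^bsub>S\<^esub> \<chi> b"
      using xy by simp
    have "\<chi> (f (x \<oplus>\<^bsub>P\<^esub> y)) = \<chi> (f x) \<oplus>\<^bsub>S\<^esub> \<chi> (f y)" using xy(1,2) \<chi> P.a_closed by (metis g.hom_add)
    then show "\<chi> (a \<oplus>\<^bsub>K\<lparr>carrier := f ` carrier P\<rparr>\<^esub> b) = \<chi> a \<oplus>\<^bsub>S\<^esub> \<chi> b"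
      using xy by simp
  next
    show "\<chi> \<one>\<^bsub>K\<lparr>carrier := f ` carrier P\<rparr>\<^esub> = \<one>\<^bsub>S\<^esub>"
      using \<chi>[OF P.one_closed] by simp
  qed
  with \<chi> show ?thesis by blast
qed

text \<open>The maps \<open>\<chi>\<close> are the points of \<open>R\<close> with values in the
  ground field, \<open>h\<close> being the structure map. Existence of some point would be too weak
  as an induction hypothesis for adjoining \<open>t\<close>: leading coefficients have to stay
  nonzero under \<open>\<chi>\<close>, so the point must be able to avoid a given
  \<open>u\<close>.\<close>

definition separated_by_points ::
    "('a, 'b) ring_scheme \<Rightarrow> ('k :: field \<Rightarrow> 'a) \<Rightarrow> 'a set \<Rightarrow> bool" where
  "separated_by_points K h R \<longleftrightarrow>
     (\<forall>u\<in>R - {\<zero>\<^bsub>K\<^esub>}. \<exists>\<chi>\<in>Ring.ring_hom (K\<lparr>carrier := R\<rparr>) class_ring. (\<forall>c. \<chi> (h c) = c) \<and> \<chi> u \<noteq> 0)"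

text \<open>Translates to type-class polynomials, for which existence of roots and finiteness of the
  set of roots are at hand.\<close>

lemma eval_class_ring_poly:
  fixes \<chi> :: "'a \<Rightarrow> 'k :: field"
  assumes "f \<in> carrier (UP R)"
  shows "eval R class_ring \<chi> \<xi> f = poly (\<Sum>i\<le>deg R f. Polynomial.monom (\<chi> (up_ring.coeff (UP R) f i)) i) \<xi>"
  using assms by (simp add: eval_def class_ring_simps poly_sum poly_monom)

lemma coeff_sum_monom:
  "poly.coeff (\<Sum>i\<le>(n::nat). Polynomial.monom (g i) i) j = (if j \<le> n then g j else 0)"
  by (simp add: coeff_sum)

text \<open>
  The Euclidean algorithm over the fraction field of \<open>R\<close>, with denominators cleared, applied to the
  minimal polynomial \<open>p\<close> of \<open>t\<close> and to \<open>g\<close>.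
\<close>

lemma (in UP_domain) nonzero_constant_multiple:
  assumes S: "domain S" and h: "h \<in> Ring.ring_hom R S" and inj: "inj_on h (carrier R)" and t: "t \<in> carrier S"
    and p: "p \<in> carrier P" "p \<noteq> \<zero>\<^bsub>P\<^esub>" "eval R S h t p = \<zero>\<^bsub>S\<^esub>"
    and pmin: "\<And>q. q \<in> carrier P \<Longrightarrow> q \<noteq> \<zero>\<^bsub>P\<^esub> \<Longrightarrow> eval R S h t q = \<zero>\<^bsub>S\<^esub> \<Longrightarrow> deg R p \<le> deg R q"
    and g: "g \<in> carrier P" "eval R S h t g \<noteq> \<zero>\<^bsub>S\<^esub>"
  shows "\<exists>f\<in>carrier P. \<exists>r\<in>carrier R - {\<zero>}. eval R S h t f \<otimes>\<^bsub>S\<^esub> eval R S h t g = h r"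
proof -
  interpret S: "domain" S by fact
  interpret h: ring_hom_cring R S h
    by (rule ring_hom_cringI[OF R.is_cring S.is_cring h])
  interpret E: UP_univ_prop R S h P t "eval R S h t"
    by unfold_locales (use t in \<open>auto simp: P_def\<close>)
  let ?ev = "eval R S h t"
  have h0: "h c \<noteq> \<zero>\<^bsub>S\<^esub>" if "c \<in> carrier R" "c \<noteq> \<zero>" for c
    using that inj h.hom_zero R.zero_closed by (metis inj_onD)
  \<comment> \<open>\<open>G\<close> collects the polynomials whose value at \<open>t\<close> is a
    nonzero multiple of the value of \<open>g\<close>. A member of least degree will turn out to be
    constant, which is the claim.\<close>
  define G where "G = {q \<in> carrier P. ?ev q \<noteq> \<zero>\<^bsub>S\<^esub> \<and> (\<exists>f\<in>carrier P. ?ev q = ?ev f \<otimes>\<^bsub>S\<^esub> ?ev g)}"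
  have "g \<in> G"
    using g by (auto simp: G_def intro!: bexI[of _ "\<one>\<^bsub>P\<^esub>"])
  then obtain q where qG: "q \<in> G" and qmin: "\<And>q'. q' \<in> G \<Longrightarrow> deg R q \<le> deg R q'"
    using ex_has_least_nat[of "\<lambda>q. q \<in> G" g "deg R"] by blast
  from qG obtain f where q: "q \<in> carrier P" "?ev q \<noteq> \<zero>\<^bsub>S\<^esub>" and f: "f \<in> carrier P" "?ev q = ?ev f \<otimes>\<^bsub>S\<^esub> ?ev g"
    by (auto simp: G_def)
  have q0: "q \<noteq> \<zero>\<^bsub>P\<^esub>" using q by auto
  have lead: "up_ring.coeff P x (deg R x) [^] (k::nat) \<in> carrier R"
       "up_ring.coeff P x (deg R x) [^] (k::nat) \<noteq> \<zero>"
    if "x \<in> carrier P" "x \<noteq> \<zero>\<^bsub>P\<^esub>" for x k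
    using that lcoeff_nonzero2[OF that] by (induction k) (auto simp: R.integral_iff)
  \<comment> \<open>Pseudo-division of \<open>q\<close> by \<open>p\<close> changes the value at
    \<open>t\<close> only by a nonzero factor from \<open>R\<close>, since \<open>p\<close> vanishes
    there. So the remainder is again in \<open>G\<close>, and \<open>q\<close> cannot have larger
    degree than it.\<close>
  have deg_qp: "deg R q < deg R p"
  proof -
    obtain s rem k where div: "s \<in> carrier P" "rem \<in> carrier P"
      "up_ring.coeff P p (deg R p) [^] (k::nat) \<odot>\<^bsub>P\<^esub> q = p \<otimes>\<^bsub>P\<^esub> s \<oplus>\<^bsub>P\<^esub> rem"
      "rem = \<zero>\<^bsub>P\<^esub> \<or> deg R rem < deg R p"
      using long_div_theorem[OF p(1) q(1) p(2)] by blast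
    let ?a = "up_ring.coeff P p (deg R p) [^] k"
    note a = lead[OF p(1,2), of k]
    have "h ?a \<otimes>\<^bsub>S\<^esub> ?ev q = ?ev p \<otimes>\<^bsub>S\<^esub> ?ev s \<oplus>\<^bsub>S\<^esub> ?ev rem"
      using arg_cong[OF div(3), of ?ev] a p(1) q(1) div(1,2) by (simp add: E.Eval_smult del: h.hom_pow)
    then have evrem: "?ev rem = h ?a \<otimes>\<^bsub>S\<^esub> ?ev q"
      using p div q(1) a by simp
    have ne: "?ev rem \<noteq> \<zero>\<^bsub>S\<^esub>"
      unfolding evrem using h0[OF a] a q by (simp add: S.integral_iff del: h.hom_pow)
    have "?ev rem = ?ev (?a \<odot>\<^bsub>P\<^esub> f) \<otimes>\<^bsub>S\<^esub> ?ev g"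
      unfolding evrem f(2) using f g a by (simp add: E.Eval_smult S.m_assoc del: h.hom_pow)
    then have "rem \<in> G"
      using ne div f a by (auto simp: G_def intro!: bexI[of _ "?a \<odot>\<^bsub>P\<^esub> f"])
    moreover have "rem \<noteq> \<zero>\<^bsub>P\<^esub>" using ne by auto
    ultimately show ?thesis using qmin div(4) by fastforce
  qed
  \<comment> \<open>Otherwise divide \<open>p\<close> by \<open>q\<close>. The value of the
    remainder is a multiple of that of \<open>g\<close>, but its degree is too small for
    \<open>G\<close>, so it vanishes at \<open>t\<close>. Then the nonzero quotient \<open>s\<close>
    vanishes at \<open>t\<close> too and has degree at least that of \<open>p\<close>, which leaves
    no room for a factor \<open>q\<close> of positive degree.\<close>
  have "deg R q = 0"
  proof (rule ccontr)
    assume "deg R q \<noteq> 0"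
    obtain s rem k where div: "s \<in> carrier P" "rem \<in> carrier P"
      "up_ring.coeff P q (deg R q) [^] (k::nat) \<odot>\<^bsub>P\<^esub> p = q \<otimes>\<^bsub>P\<^esub> s \<oplus>\<^bsub>P\<^esub> rem"
      "rem = \<zero>\<^bsub>P\<^esub> \<or> deg R rem < deg R q"
      using long_div_theorem[OF q(1) p(1) q0] by blast
    let ?a = "up_ring.coeff P q (deg R q) [^] k"
    note a = lead[OF q(1) q0, of k]
    have ev0: "\<zero>\<^bsub>S\<^esub> = ?ev q \<otimes>\<^bsub>S\<^esub> ?ev s \<oplus>\<^bsub>S\<^esub> ?ev rem"
      using arg_cong[OF div(3), of ?ev] a p q(1) div(1,2) by (simp add: E.Eval_smult del: h.hom_pow)
    have evrem: "?ev rem = \<zero>\<^bsub>S\<^esub>"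
    proof (cases "rem = \<zero>\<^bsub>P\<^esub>")
      case False
      have "?ev rem = \<ominus>\<^bsub>S\<^esub> (?ev q \<otimes>\<^bsub>S\<^esub> ?ev s)"
        using ev0 q(1) div(1,2) by (metis S.add.inv_equality S.add.m_comm E.hom_closed S.m_closed S.minus_equality)
      also have "\<dots> = ?ev (\<ominus>\<^bsub>P\<^esub> (s \<otimes>\<^bsub>P\<^esub> f)) \<otimes>\<^bsub>S\<^esub> ?ev g"
        unfolding f(2) using f(1) g(1) div(1,2) by (simp add: S.l_minus S.r_minus S.m_ac)
      finally have "?ev rem = \<zero>\<^bsub>S\<^esub> \<or> rem \<in> G"
        using div(1,2) f(1) by (auto simp: G_def intro!: bexI[of _ "\<ominus>\<^bsub>P\<^esub> (s \<otimes>\<^bsub>P\<^esub> f)"])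
      then show ?thesis using qmin False div(4) by fastforce
    qed simp
    have "?ev q \<otimes>\<^bsub>S\<^esub> ?ev s = \<zero>\<^bsub>S\<^esub>"
      using ev0 evrem q(1) div(1,2) by simp
    then have evs: "?ev s = \<zero>\<^bsub>S\<^esub>"
      using q div(1) S.integral_iff by blast
    have degap: "deg R (?a \<odot>\<^bsub>P\<^esub> p) = deg R p"
      using a p by simp
    have "s \<noteq> \<zero>\<^bsub>P\<^esub>"
    proof
      assume "s = \<zero>\<^bsub>P\<^esub>"
      then have "?a \<odot>\<^bsub>P\<^esub> p = rem" using div q by simp
      then have "deg R rem = deg R p" using degap by simp
      then have "rem = \<zero>\<^bsub>P\<^esub>" using div(4) deg_qp by auto
      then show False using \<open>deg R rem = deg R p\<close> deg_qp by simp
    qed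
    then have "deg R p \<le> deg R s" using pmin div(1) evs by blast
    moreover have "deg R (q \<otimes>\<^bsub>P\<^esub> s) = deg R q + deg R s"
      using q(1) q0 div(1) \<open>s \<noteq> _\<close> by simp
    moreover have "deg R (q \<otimes>\<^bsub>P\<^esub> s) \<le> deg R p"
    proof -
      have "q \<otimes>\<^bsub>P\<^esub> s = ?a \<odot>\<^bsub>P\<^esub> p \<oplus>\<^bsub>P\<^esub> \<ominus>\<^bsub>P\<^esub> rem"
        unfolding div(3) using q(1) div(1,2) by (simp add: P.a_assoc P.r_neg)
      then have "deg R (q \<otimes>\<^bsub>P\<^esub> s) \<le> max (deg R (?a \<odot>\<^bsub>P\<^esub> p)) (deg R (\<ominus>\<^bsub>P\<^esub> rem))"
        using p(1) a div(2) by (metis deg_add UP_smult_closed UP_a_inv_closed)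
      also have "\<dots> \<le> deg R p"
        using degap div deg_qp by auto
      finally show ?thesis .
    qed
    ultimately show False using \<open>deg R q \<noteq> 0\<close> by simp
  qed
  then obtain r where r: "r \<in> carrier R" "q = up_ring.monom P r 0"
    using deg_zero_impl_monom[OF q(1)] q(1) coeff_closed by metis
  have evq: "?ev q = h r" using r E.eval_const[OF t] by simp
  have "r \<noteq> \<zero>" using evq q(2) by auto
  then show ?thesis using r f evq by (metis DiffI singletonD)
qed

lemma root_of_leading_coeff:
  fixes f :: "nat \<Rightarrow> 'k :: alg_closed_field"
  assumes "n > 0" "f n \<noteq> 0"
  shows "\<exists>\<xi>. poly (\<Sum>i\<le>n. Polynomial.monom (f i) i) \<xi> = 0"
  using alg_closed[of n f] assms by (simp add: poly_sum poly_monom)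

text \<open>Characteristic zero enters as infiniteness of the field, which the finitely many roots
  of a nonzero polynomial cannot exhaust.\<close>

lemma nonroot_of_leading_coeff:
  fixes f :: "nat \<Rightarrow> 'k :: field_char_0"
  assumes "f n \<noteq> 0"
  shows "\<exists>\<xi>. poly (\<Sum>i\<le>n. Polynomial.monom (f i) i) \<xi> \<noteq> 0"
proof -
  define p where "p = (\<Sum>i\<le>n. Polynomial.monom (f i) i)"
  have "poly.coeff p n \<noteq> 0"
    using assms by (simp add: coeff_sum_monom p_def)
  then have "finite {\<xi>. poly p \<xi> = 0}" by (intro poly_roots_finite) auto
  then have "{\<xi>. poly p \<xi> = 0} \<noteq> UNIV" using infinite_UNIV_char_0[where 'a='k] by metis
  then show ?thesis unfolding p_def[symmetric] by blast
qed

text \<open>\<open>T\<close> is \<open>R[t]\<close>, the image of evaluation at \<open>t\<close>. A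
  point of it consists of a point \<open>\<chi>\<close> of \<open>R\<close> and a value
  \<open>\<xi>\<close> for \<open>t\<close>, to be chosen so that \<open>u = g(t)\<close> stays
  nonzero. If \<open>t\<close> is algebraic over \<open>R\<close>, then \<open>\<xi>\<close> must be
  a root of the specialised relation of least degree, and \<open>nonzero_constant_multiple\<close>
  turns the condition on \<open>u\<close> into one on an element of \<open>R\<close>.\<close>

lemma separated_by_points_adjoin:
  fixes h :: "'k :: {alg_closed_field, field_char_0} \<Rightarrow> 'a"
  assumes dom: "domain K" and R: "subring R K" and h: "range h \<subseteq> R"
    and sep: "separated_by_points K h R" and t: "t \<in> carrier K"
  shows "\<exists>T. subring T K \<and> insert t R \<subseteq> T \<and> separated_by_points K h T"
proof -
  interpret K: "domain" K by fact
  define R' where "R' = K\<lparr>carrier := R\<rparr>"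
  interpret R': "domain" R' unfolding R'_def by (rule K.subring_is_domain[OF R])
  have R'_simps [simp]: "carrier R' = R" "\<zero>\<^bsub>R'\<^esub> = \<zero>\<^bsub>K\<^esub>" "\<one>\<^bsub>R'\<^esub> = \<one>\<^bsub>K\<^esub>" "mult R' = mult K" "add R' = add K"
    by (auto simp: R'_def)
  have RK: "R \<subseteq> carrier K" by (rule subringE(1)[OF R])
  have id: "id \<in> Ring.ring_hom R' K"
    using RK by (auto intro!: ring_hom_memI)
  define P where "P = UP R'"
  interpret UP_domain R' P by unfold_locales (simp add: P_def)
  interpret idh: ring_hom_cring R' K id
    by (rule ring_hom_cringI[OF R'.is_cring K.is_cring id])
  interpret E: UP_univ_prop R' K id P t "eval R' K id t"
    by unfold_locales (use t in \<open>auto simp: P_def\<close>)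
  let ?ev = "eval R' K id t"
  have E_ring: "ring_hom_ring P K ?ev"
    by (rule ring_hom_ringI2[OF P.ring_axioms K.ring_axioms E.homh])
  let ?T = "?ev ` carrier P"
  have T: "subring ?T K"
    using ring_hom_ring.img_is_subring[OF E_ring P.carrier_is_subring] .
  have RT: "R \<subseteq> ?T"
  proof
    fix r assume "r \<in> R"
    then show "r \<in> ?T" using E.eval_const[OF t, of r]
      by (intro image_eqI[of _ _ "up_ring.monom P r 0"]) auto
  qed
  have tT: "t \<in> ?T"
    using E.eval_monom1[OF t] by (intro image_eqI[of _ _ "up_ring.monom P \<one>\<^bsub>K\<^esub> 1"]) (auto simp: subringE(3)[OF R])
  have "separated_by_points K h ?T"
    unfolding separated_by_points_def
  proof
    fix u assume "u \<in> ?T - {\<zero>\<^bsub>K\<^esub>}"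
    then obtain g where g: "g \<in> carrier P" "?ev g = u" "u \<noteq> \<zero>\<^bsub>K\<^esub>" by auto
    let ?goal = "\<exists>\<chi>\<in>Ring.ring_hom (K\<lparr>carrier := ?T\<rparr>) class_ring. (\<forall>c. \<chi> (h c) = c) \<and> \<chi> u \<noteq> 0"
    \<comment> \<open>\<open>\<chi>\<close> and \<open>\<xi>\<close> define a point of
      \<open>R[t]\<close> as soon as every relation of \<open>t\<close> over \<open>R\<close>
      specialises to a relation of \<open>\<xi>\<close>; this is the assumption
      \<open>ker\<close>.\<close>
    have lift: ?goal
      if \<chi>: "\<chi> \<in> Ring.ring_hom R' class_ring" "\<forall>c. \<chi> (h c) = c"
        and ker: "\<And>f. f \<in> carrier P \<Longrightarrow> ?ev f = \<zero>\<^bsub>K\<^esub> \<Longrightarrow> eval R' class_ring \<chi> \<xi> f = 0"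
        and u: "eval R' class_ring \<chi> \<xi> g \<noteq> 0" for \<chi> and \<xi> :: 'k
    proof -
      interpret C: ring_hom_cring R' class_ring \<chi>
        by (rule ring_hom_cringI[OF R'.is_cring class_cring.is_cring \<chi>(1)])
      interpret C: UP_pre_univ_prop R' class_ring \<chi> P by unfold_locales
      have ev: "eval R' class_ring \<chi> \<xi> \<in> Ring.ring_hom P class_ring"
        by (rule C.eval_ring_hom) simp
      obtain \<psi> where \<psi>: "\<psi> \<in> Ring.ring_hom (K\<lparr>carrier := ?T\<rparr>) class_ring"
        "\<And>f. f \<in> carrier P \<Longrightarrow> \<psi> (?ev f) = eval R' class_ring \<chi> \<xi> f"
        using ring_hom_factor[OF P.ring_axioms K.ring_axioms class_ring.ring_axioms E.homh ev] ker by auto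
      have "\<psi> (h c) = c" for c
      proof -
        have "h c \<in> R" using h by auto
        then have "\<psi> (h c) = eval R' class_ring \<chi> \<xi> (up_ring.monom P (h c) 0)"
          using \<psi>(2)[of "up_ring.monom P (h c) 0"] E.eval_const[OF t, of "h c"] by simp
        also have "\<dots> = \<chi> (h c)"
          using \<open>h c \<in> R\<close> C.eval_const[of \<xi> "h c"] by simp
        finally show ?thesis using \<chi> by simp
      qed
      moreover have "\<psi> u \<noteq> 0" using \<psi>(2)[OF g(1)] g(2) u by simp
      ultimately show ?thesis using \<psi>(1) by blast
    qed
    show ?goal
    proof (cases "\<exists>p\<in>carrier P. p \<noteq> \<zero>\<^bsub>P\<^esub> \<and> ?ev p = \<zero>\<^bsub>K\<^esub>")
      \<comment> \<open>The transcendental case: with no relations to respect, every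
        \<open>\<xi>\<close> is admissible. \<open>\<chi>\<close> keeps the leading coefficient of
        \<open>g\<close> nonzero, and \<open>\<xi>\<close> avoids the roots of the specialised
        \<open>g\<close>.\<close>
      case False
      have "g \<noteq> \<zero>\<^bsub>P\<^esub>" using g by auto
      let ?r = "up_ring.coeff P g (deg R' g)"
      have r: "?r \<in> R - {\<zero>\<^bsub>K\<^esub>}"
        using lcoeff_nonzero2[OF g(1) \<open>g \<noteq> _\<close>] lcoeff_closed[OF g(1)] by simp
      obtain \<chi> where \<chi>: "\<chi> \<in> Ring.ring_hom R' class_ring" "\<forall>c. \<chi> (h c) = c" "\<chi> ?r \<noteq> 0"
        using sep r unfolding separated_by_points_def R'_def[symmetric] by blast
      obtain \<xi> where \<xi>: "poly (\<Sum>i\<le>deg R' g. Polynomial.monom (\<chi> (up_ring.coeff P g i)) i) \<xi> \<noteq> 0"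
        using nonroot_of_leading_coeff[of "\<lambda>i. \<chi> (up_ring.coeff P g i)" "deg R' g"] \<chi>(3) by blast
      have u: "eval R' class_ring \<chi> \<xi> g \<noteq> 0"
        using \<xi> eval_class_ring_poly[of g R' \<chi> \<xi>] g(1) by (simp add: P_def)
      interpret C: ring_hom_cring R' class_ring \<chi>
        by (rule ring_hom_cringI[OF R'.is_cring class_cring.is_cring \<chi>(1)])
      interpret C: UP_univ_prop R' class_ring \<chi> P \<xi> "eval R' class_ring \<chi> \<xi>"
        by unfold_locales simp_all
      have "eval R' class_ring \<chi> \<xi> f = 0" if "f \<in> carrier P" "?ev f = \<zero>\<^bsub>K\<^esub>" for f
        using False that C.hom_zero by auto
      then show ?thesis using lift \<chi> u by blast
    next
      case True
      define Z where "Z = {p \<in> carrier P. p \<noteq> \<zero>\<^bsub>P\<^esub> \<and> ?ev p = \<zero>\<^bsub>K\<^esub>}"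
      have "\<exists>p. p \<in> Z" using True by (auto simp: Z_def)
      then obtain p where "p \<in> Z" and Zmin: "\<And>q. q \<in> Z \<Longrightarrow> deg R' p \<le> deg R' q"
        using ex_has_least_nat[of "\<lambda>p. p \<in> Z" _ "deg R'"] by blast
      then have p: "p \<in> carrier P" "p \<noteq> \<zero>\<^bsub>P\<^esub>" "?ev p = \<zero>\<^bsub>K\<^esub>" by (auto simp: Z_def)
      have pmin: "deg R' p \<le> deg R' q" if "q \<in> carrier P" "q \<noteq> \<zero>\<^bsub>P\<^esub>" "?ev q = \<zero>\<^bsub>K\<^esub>" for q
        using Zmin that by (simp add: Z_def)
      let ?a = "up_ring.coeff P p (deg R' p)"
      have a: "?a \<in> R" "?a \<noteq> \<zero>\<^bsub>K\<^esub>"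
        using lcoeff_nonzero2[OF p(1,2)] lcoeff_closed[OF p(1)] by simp_all
      obtain f r where f: "f \<in> carrier P" and r: "r \<in> R" "r \<noteq> \<zero>\<^bsub>K\<^esub>" "?ev f \<otimes>\<^bsub>K\<^esub> u = r"
        using nonzero_constant_multiple[OF dom id inj_on_id t p pmin g(1)] g(2,3) unfolding R'_simps id_apply by blast
      \<comment> \<open>Separation avoids a single element, so two conditions are merged into a
        product: \<open>?a\<close> must survive so that the specialised \<open>p\<close> has a root
        and pseudo-division by \<open>p\<close> can be undone, and \<open>r\<close> must survive so
        that \<open>u\<close> does.\<close>
      have "?a \<otimes>\<^bsub>K\<^esub> r \<in> R - {\<zero>\<^bsub>K\<^esub>}"
        using subringE(6)[OF R a(1) r(1)] K.integral[of ?a r] a r RK by blast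
      then obtain \<chi> where \<chi>: "\<chi> \<in> Ring.ring_hom R' class_ring" "\<forall>c. \<chi> (h c) = c" "\<chi> (?a \<otimes>\<^bsub>K\<^esub> r) \<noteq> 0"
        using sep unfolding separated_by_points_def R'_def[symmetric] by blast
      have \<chi>ar: "\<chi> ?a \<noteq> 0" "\<chi> r \<noteq> 0"
        using \<chi>(3) ring_hom_mult[OF \<chi>(1), of ?a r] a r by auto
      have "deg R' p \<noteq> 0"
      proof
        assume "deg R' p = 0"
        then have "p = up_ring.monom P ?a 0" using deg_zero_impl_monom[OF p(1)] by simp
        then have "?ev p = ?a" using E.eval_const[OF t, of ?a] a by simp
        then show False using p(3) a by simp
      qed
      then obtain \<xi> where \<xi>: "poly (\<Sum>i\<le>deg R' p. Polynomial.monom (\<chi> (up_ring.coeff P p i)) i) \<xi> = 0"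
        using root_of_leading_coeff[of "deg R' p" "\<lambda>i. \<chi> (up_ring.coeff P p i)"] \<chi>ar by blast
      let ?ex = "eval R' class_ring \<chi> \<xi>"
      have exp: "?ex p = 0"
        using \<xi> eval_class_ring_poly[of p R' \<chi> \<xi>] p(1) by (simp add: P_def)
      interpret C: ring_hom_cring R' class_ring \<chi>
        by (rule ring_hom_cringI[OF R'.is_cring class_cring.is_cring \<chi>(1)])
      interpret C: UP_univ_prop R' class_ring \<chi> P \<xi> ?ex
        by unfold_locales simp_all
      \<comment> \<open>Up to a power of \<open>?a\<close>, a relation \<open>q\<close> is a
        multiple of \<open>p\<close>: the remainder vanishes at \<open>t\<close> and its degree is
        below the least one. As \<open>\<xi>\<close> is a root of the specialised \<open>p\<close>
        and \<open>\<chi> ?a\<close> is invertible, \<open>q\<close> specialises to a relation of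
        \<open>\<xi>\<close>.\<close>
      have ker: "?ex q = 0" if q: "q \<in> carrier P" "?ev q = \<zero>\<^bsub>K\<^esub>" for q
      proof -
        obtain s rem k where div: "s \<in> carrier P" "rem \<in> carrier P"
          "?a [^]\<^bsub>R'\<^esub> (k::nat) \<odot>\<^bsub>P\<^esub> q = p \<otimes>\<^bsub>P\<^esub> s \<oplus>\<^bsub>P\<^esub> rem"
          "rem = \<zero>\<^bsub>P\<^esub> \<or> deg R' rem < deg R' p"
          using long_div_theorem[OF p(1) q(1) p(2)] by blast
        have ak: "?a [^]\<^bsub>R'\<^esub> k \<in> carrier R'" using R'.nat_pow_closed a by auto
        then have akK: "?a [^]\<^bsub>R'\<^esub> k \<in> carrier K" using RK by auto
        have "?ev rem = \<zero>\<^bsub>K\<^esub>"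
          using arg_cong[OF div(3), of ?ev] ak akK p q div(1,2) by (simp add: E.Eval_smult)
        then have "rem = \<zero>\<^bsub>P\<^esub>" using div(2,4) pmin[OF div(2)] by (metis not_le)
        then have "\<chi> (?a [^]\<^bsub>R'\<^esub> k) * ?ex q = 0"
          using arg_cong[OF div(3), of ?ex] ak p(1) q exp div(1,2) by (simp add: C.Eval_smult del: C.hom_pow)
        moreover have "\<chi> (?a [^]\<^bsub>R'\<^esub> k) = \<chi> ?a ^ k"
          using a by (simp add: class_ring_simps)
        ultimately show ?thesis using \<chi>ar by simp
      qed
      \<comment> \<open>\<open>f g - r\<close> is a relation of \<open>t\<close>. By
        \<open>ker\<close> the values of \<open>f\<close> and \<open>g\<close> at
        \<open>\<xi>\<close> therefore multiply to \<open>\<chi> r\<close>, which is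
        nonzero.\<close>
      have u: "?ex g \<noteq> 0"
      proof
        assume ex0: "?ex g = 0"
        have rP: "up_ring.monom P r 0 \<in> carrier P" using r by simp
        have "?ev (f \<otimes>\<^bsub>P\<^esub> g \<ominus>\<^bsub>P\<^esub> up_ring.monom P r 0) = \<zero>\<^bsub>K\<^esub>"
          using f g r rP RK E.eval_const[OF t, of r] by (auto simp: P.minus_eq K.r_neg subset_iff)
        then have "?ex (f \<otimes>\<^bsub>P\<^esub> g \<ominus>\<^bsub>P\<^esub> up_ring.monom P r 0) = 0"
          using ker f g rP by simp
        then have "?ex (up_ring.monom P r 0) = 0"
          using f g(1) rP ex0 by (simp add: P.minus_eq class_ring_simps)
        then show False using C.eval_const[of \<xi> r] r \<chi>ar by simp
      qed
      show ?thesis using lift[OF \<chi>(1,2) ker u] .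
    qed
  qed
  then show ?thesis using T RT tT by blast
qed

text \<open>One element is adjoined at a time. The start is \<open>range h\<close>, a copy of the
  ground field: \<open>h\<close> is injective because the field has inverses and \<open>K\<close> is
  not zero, and the inverse of \<open>h\<close> is a point that avoids every nonzero
  element.\<close>

lemma separated_by_points_finite:
  fixes h :: "'k :: {alg_closed_field, field_char_0} \<Rightarrow> 'a"
  assumes dom: "domain K" and h: "h \<in> Ring.ring_hom class_ring K" and X: "finite X" "X \<subseteq> carrier K"
  shows "\<exists>T. subring T K \<and> range h \<union> X \<subseteq> T \<and> separated_by_points K h T"
  using X
proof (induction X rule: finite_induct)
  case empty
  interpret K: "domain" K by fact
  note h_ring = ring_hom_ringI2[OF class_ring.ring_axioms K.ring_axioms h]
  have closed: "h c \<in> carrier K" for c using ring_hom_closed[OF h, of c] by simp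
  have one: "h 1 = \<one>\<^bsub>K\<^esub>" using ring_hom_one[OF h] by simp
  have mult: "h (c * d) = h c \<otimes>\<^bsub>K\<^esub> h d" for c d using ring_hom_mult[OF h, of c d] by simp
  have zero: "h 0 = \<zero>\<^bsub>K\<^esub>"
    using ring_hom_zero[OF h class_ring.ring_axioms K.ring_axioms] by simp
  have "subring (range h) K"
    using ring_hom_ring.img_is_subring[OF h_ring ring.carrier_is_subring[OF class_ring.ring_axioms]] by simp
  moreover have "separated_by_points K h (range h)"
  proof -
    have inj: "c = 0" if "h c = \<zero>\<^bsub>K\<^esub>" for c
    proof (rule ccontr)
      assume "c \<noteq> 0"
      then have "\<one>\<^bsub>K\<^esub> = h c \<otimes>\<^bsub>K\<^esub> h (inverse c)" unfolding mult[symmetric] one[symmetric] by simp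
      also have "\<dots> = \<zero>\<^bsub>K\<^esub>" using that closed[of "inverse c"] by simp
      finally show False using K.one_not_zero by simp
    qed
    have id: "(\<lambda>c. c) \<in> Ring.ring_hom (class_ring :: 'k ring) class_ring"
      by (auto intro!: ring_hom_memI)
    have "\<exists>\<chi>\<in>Ring.ring_hom (K\<lparr>carrier := h ` carrier class_ring\<rparr>) class_ring.
        \<forall>c\<in>carrier class_ring. \<chi> (h c) = c"
      by (rule ring_hom_factor[OF class_ring.ring_axioms K.ring_axioms class_ring.ring_axioms h id])
        (simp add: inj)
    then obtain \<chi> where \<chi>: "\<chi> \<in> Ring.ring_hom (K\<lparr>carrier := range h\<rparr>) class_ring" "\<forall>c. \<chi> (h c) = c"
      by auto
    have "\<chi> u \<noteq> 0" if "u \<in> range h - {\<zero>\<^bsub>K\<^esub>}" for u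
    proof -
      from that obtain c where "u = h c" "h c \<noteq> \<zero>\<^bsub>K\<^esub>" by auto
      then show ?thesis using zero \<chi>(2) by metis
    qed
    then show ?thesis
      unfolding separated_by_points_def by (intro ballI bexI[OF _ \<chi>(1)] conjI \<chi>(2))
  qed
  ultimately show ?case by (intro exI[of _ "range h"]) simp
next
  case (insert x X)
  then obtain T where T: "subring T K" "range h \<union> X \<subseteq> T" "separated_by_points K h T" by auto
  then show ?case
    using separated_by_points_adjoin[OF dom T(1) _ T(3), of x] insert.prems by (metis Un_insert_right insert_subset le_sup_iff subset_trans)
qed

text \<open>\<open>gen\<close> expresses that \<open>X\<close> generates \<open>K\<close> over the
  ground field. Hence the separated ring containing \<open>X\<close> is \<open>K\<close> itself, and
  avoiding the element \<open>1\<close> already produces a point.\<close>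

theorem weak_nullstellensatz:
  fixes h :: "'k :: {alg_closed_field, field_char_0} \<Rightarrow> 'a"
  assumes dom: "domain (K :: 'a ring)" and h: "h \<in> Ring.ring_hom class_ring K"
    and X: "finite X" "X \<subseteq> carrier K"
    and gen: "\<And>T. subring T K \<Longrightarrow> range h \<union> X \<subseteq> T \<Longrightarrow> carrier K \<subseteq> T"
  shows "\<exists>\<chi>\<in>Ring.ring_hom K class_ring. \<forall>c. \<chi> (h c) = c"
proof -
  interpret K: "domain" K by fact
  obtain T where T: "subring T K" "range h \<union> X \<subseteq> T" "separated_by_points K h T"
    using separated_by_points_finite[OF dom h X] by blast
  then have "T = carrier K" using gen subringE(1) by blast
  then have "\<one>\<^bsub>K\<^esub> \<in> T - {\<zero>\<^bsub>K\<^esub>}" "K\<lparr>carrier := T\<rparr> = K"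
    using K.one_closed K.one_not_zero by simp_all
  then show ?thesis
    using T(3) unfolding separated_by_points_def by metis
qed

section \<open>Subalgebras and characters\<close>

lemma subspace_iff:
  assumes "vectorspace class_ring (W :: ('k :: field, 'w) module)"
  shows "VectorSpace.subspace class_ring U W \<longleftrightarrow>
    U \<subseteq> carrier W \<and> \<zero>\<^bsub>W\<^esub> \<in> U \<and> (\<forall>v\<in>U. \<forall>w\<in>U. v \<oplus>\<^bsub>W\<^esub> w \<in> U) \<and> (\<forall>c. \<forall>w\<in>U. c \<odot>\<^bsub>W\<^esub> w \<in> U)"
proof -
  interpret W: vectorspace class_ring W by fact
  show ?thesis
    using assms W.module_axioms
    unfolding VectorSpace.subspace_def LinearCombinations.submodule_def by auto
qed

context unital_algebra
begin

lemma subspace_alg_iff: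
  "VectorSpace.subspace class_ring U A \<longleftrightarrow>
    U \<subseteq> carrier A \<and> \<zero> \<in> U \<and> (\<forall>v\<in>U. \<forall>w\<in>U. v \<oplus> w \<in> U) \<and> (\<forall>c. \<forall>w\<in>U. c \<odot> w \<in> U)"
  by (rule subspace_iff[OF vs.vectorspace_axioms])

lemma smult_closed' [simp, intro]: "x \<in> carrier A \<Longrightarrow> c \<odot> x \<in> carrier A"
  using vs.smult_closed by simp

lemma smult_zero_left: "x \<in> carrier A \<Longrightarrow> 0 \<odot> x = \<zero>"
  using vs.smult_l_null[of x] by simp

lemma smult_minus_one: "x \<in> carrier A \<Longrightarrow> (- 1) \<odot> x = \<ominus> x"
  using vs.smult_l_minus[of 1 x] vs.smult_one[of x] by (simp add: class_ring_simps)

lemma smult_r_distr': "x \<in> carrier A \<Longrightarrow> y \<in> carrier A \<Longrightarrow> c \<odot> (x \<oplus> y) = c \<odot> x \<oplus> c \<odot> y"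
  using vs.smult_r_distr[of c x y] by simp

lemma smult_l_distr': "x \<in> carrier A \<Longrightarrow> (c + d) \<odot> x = c \<odot> x \<oplus> d \<odot> x"
  using vs.smult_l_distr[of c d x] by simp

lemma smult_eq_mult_one: "x \<in> carrier A \<Longrightarrow> c \<odot> x = (c \<odot> \<one>) \<otimes> x"
  using smult_mult_left[of \<one> x c] by simp

lemma subspace_minus:
  assumes "VectorSpace.subspace class_ring U A" "x \<in> U" "y \<in> U"
  shows "x \<ominus> y \<in> U"
proof -
  have "x \<ominus> y = x \<oplus> (- 1) \<odot> y"
    using assms by (auto simp: subspace_alg_iff smult_minus_one minus_eq)
  then show ?thesis using assms by (simp add: subspace_alg_iff)
qed

lemma subalgebra_of_iff:
  "subalgebra_of T A \<longleftrightarrow> T \<subseteq> carrier A \<and> \<one> \<in> T \<and> (\<forall>v\<in>T. \<forall>w\<in>T. v \<oplus> w \<in> T) \<and>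
     (\<forall>v\<in>T. \<forall>w\<in>T. v \<otimes> w \<in> T) \<and> (\<forall>c. \<forall>w\<in>T. c \<odot> w \<in> T)" (is "?L \<longleftrightarrow> ?R")
proof
  assume ?L
  then show ?R
    unfolding subalgebra_of_def subspace_alg_iff by (metis subringE(3,6))
next
  assume R: ?R
  have "\<ominus> x \<in> T" if "x \<in> T" for x
    using R that smult_minus_one[of x] by (metis subsetD)
  then have sub: "subring T A" using R by (intro subringI) auto
  show ?L unfolding subalgebra_of_def subspace_alg_iff using R sub subringE(2)[OF sub] by simp
qed

lemma subalgebraD:
  assumes "subalgebra_of T A"
  shows "T \<subseteq> carrier A" "\<one> \<in> T" "\<zero> \<in> T" "v \<in> T \<Longrightarrow> w \<in> T \<Longrightarrow> v \<oplus> w \<in> T"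
    "v \<in> T \<Longrightarrow> w \<in> T \<Longrightarrow> v \<otimes> w \<in> T" "v \<in> T \<Longrightarrow> c \<odot> v \<in> T" "v \<in> T \<Longrightarrow> \<ominus> v \<in> T"
    "VectorSpace.subspace class_ring T A" "subring T A"
proof -
  show "VectorSpace.subspace class_ring T A" and sub: "subring T A"
    using assms by (auto simp: subalgebra_of_def)
  show "\<zero> \<in> T" "v \<in> T \<Longrightarrow> \<ominus> v \<in> T" using subringE(2,5)[OF sub] by simp_all
qed (use assms in \<open>auto simp: subalgebra_of_iff\<close>)

lemma generated_subalgebra:
  assumes "X \<subseteq> carrier A"
  shows "subalgebra_of (generated_subalgebra A X) A" "X \<subseteq> generated_subalgebra A X"
proof -
  have "subalgebra_of (carrier A) A" by (auto simp: subalgebra_of_iff)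
  moreover have mem: "v \<in> generated_subalgebra A X \<longleftrightarrow> (\<forall>T. subalgebra_of T A \<longrightarrow> X \<subseteq> T \<longrightarrow> v \<in> T)" for v
    by (auto simp: generated_subalgebra_def)
  ultimately have "generated_subalgebra A X \<subseteq> carrier A" using assms by blast
  then show "subalgebra_of (generated_subalgebra A X) A"
    unfolding subalgebra_of_iff by (simp add: mem subalgebraD)
qed (auto simp: generated_subalgebra_def)

lemma generated_subalgebra_least:
  "subalgebra_of T A \<Longrightarrow> X \<subseteq> T \<Longrightarrow> generated_subalgebra A X \<subseteq> T"
  by (auto simp: generated_subalgebra_def)

lemma subalgebra_centralizer:
  assumes "X \<subseteq> carrier A"
  shows "subalgebra_of {y \<in> carrier A. \<forall>x\<in>X. x \<otimes> y = y \<otimes> x} A" (is "subalgebra_of ?Z A")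
  unfolding subalgebra_of_iff
proof (intro conjI ballI allI)
  fix v w assume v: "v \<in> ?Z" and w: "w \<in> ?Z"
  show "v \<oplus> w \<in> ?Z"
    using v w assms by (auto simp: l_distr r_distr)
  have "x \<otimes> (v \<otimes> w) = v \<otimes> w \<otimes> x" if "x \<in> X" for x
  proof -
    have [simp]: "x \<in> carrier A" "v \<in> carrier A" "w \<in> carrier A" "x \<otimes> v = v \<otimes> x" "x \<otimes> w = w \<otimes> x"
      using that v w assms by auto
    have "x \<otimes> (v \<otimes> w) = v \<otimes> (x \<otimes> w)" by (simp add: m_assoc[symmetric] del: \<open>x \<otimes> w = _\<close>)
    then show ?thesis by (simp add: m_assoc)
  qed
  then show "v \<otimes> w \<in> ?Z" using v w by auto
next
  fix c v assume "v \<in> ?Z"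
  then show "c \<odot> v \<in> ?Z"
    using assms by (auto simp: smult_mult_left[symmetric] smult_mult_right[symmetric] subset_iff)
qed (use assms in auto)

text \<open>A double centralizer argument. The centralizer of \<open>X\<close> is a subalgebra
  containing \<open>X\<close>, hence containing the generated one; so \<open>X\<close> lies in the
  centralizer of the generated subalgebra, which is again a subalgebra.\<close>

lemma generated_subalgebra_commute:
  assumes X: "X \<subseteq> carrier A" and comm: "\<And>x y. x \<in> X \<Longrightarrow> y \<in> X \<Longrightarrow> x \<otimes> y = y \<otimes> x"
    and "u \<in> generated_subalgebra A X" "v \<in> generated_subalgebra A X"
  shows "u \<otimes> v = v \<otimes> u"
proof -
  let ?C = "generated_subalgebra A X"
  have C: "?C \<subseteq> carrier A" using generated_subalgebra[OF X] subalgebraD by blast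
  have 1: "?C \<subseteq> {y \<in> carrier A. \<forall>x\<in>X. x \<otimes> y = y \<otimes> x}"
    by (rule generated_subalgebra_least[OF subalgebra_centralizer[OF X]]) (use X comm in auto)
  have "?C \<subseteq> {y \<in> carrier A. \<forall>x\<in>?C. x \<otimes> y = y \<otimes> x}"
  proof (rule generated_subalgebra_least[OF subalgebra_centralizer[OF C]], rule subsetI)
    fix y assume "y \<in> X"
    moreover have "x \<otimes> y = y \<otimes> x" if "x \<in> ?C" for x
    proof -
      have "x \<in> {y \<in> carrier A. \<forall>x\<in>X. x \<otimes> y = y \<otimes> x}" using subsetD[OF 1 that] .
      then show ?thesis using \<open>y \<in> X\<close> by simp
    qed
    ultimately show "y \<in> {y \<in> carrier A. \<forall>x\<in>?C. x \<otimes> y = y \<otimes> x}" using X by auto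
  qed
  from subsetD[OF this assms(4)] show ?thesis using assms(3) by simp
qed

end

text \<open>The conditions on \<open>M\<close> describe a prime ideal of the commutative ring
  \<open>C\<close>, in the operations of \<open>A\<close>. The quotient is a domain generated over
  the field by the images of \<open>X\<close>, so it has a point, and \<open>\<chi>\<close> is that
  point composed with the quotient map.\<close>

lemma character_of_generated:
  fixes A :: "('k :: {alg_closed_field, field_char_0}, 'a) module"
  assumes "unital_algebra A" and X: "finite X" "X \<subseteq> carrier A"
    and comm: "\<And>x y. x \<in> X \<Longrightarrow> y \<in> X \<Longrightarrow> x \<otimes>\<^bsub>A\<^esub> y = y \<otimes>\<^bsub>A\<^esub> x"
    and C: "C = generated_subalgebra A X"
    and M: "M \<subseteq> C" "\<zero>\<^bsub>A\<^esub> \<in> M" "\<one>\<^bsub>A\<^esub> \<notin> M"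
      "\<And>x y. x \<in> M \<Longrightarrow> y \<in> M \<Longrightarrow> x \<oplus>\<^bsub>A\<^esub> y \<in> M"
      "\<And>c x. c \<in> C \<Longrightarrow> x \<in> M \<Longrightarrow> c \<otimes>\<^bsub>A\<^esub> x \<in> M"
      "\<And>x y. x \<in> C \<Longrightarrow> y \<in> C \<Longrightarrow> x \<otimes>\<^bsub>A\<^esub> y \<in> M \<Longrightarrow> x \<in> M \<or> y \<in> M"
  shows "\<exists>\<chi>. \<chi> \<one>\<^bsub>A\<^esub> = 1 \<and> (\<forall>x\<in>C. \<forall>y\<in>C. \<chi> (x \<oplus>\<^bsub>A\<^esub> y) = \<chi> x + \<chi> y) \<and>
    (\<forall>x\<in>C. \<forall>y\<in>C. \<chi> (x \<otimes>\<^bsub>A\<^esub> y) = \<chi> x * \<chi> y) \<and>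
    (\<forall>c. \<forall>x\<in>C. \<chi> (c \<odot>\<^bsub>A\<^esub> x) = c * \<chi> x) \<and> (\<forall>x\<in>M. \<chi> x = (0 :: 'k))"
proof -
  interpret A: unital_algebra A by fact
  have algC: "subalgebra_of C A" and XC: "X \<subseteq> C"
    using A.generated_subalgebra[OF X(2)] by (simp_all add: C)
  note CD = A.subalgebraD[OF algC]
  have commC: "x \<otimes>\<^bsub>A\<^esub> y = y \<otimes>\<^bsub>A\<^esub> x" if "x \<in> C" "y \<in> C" for x y
    using A.generated_subalgebra_commute[OF X(2) comm] that by (simp add: C)
  define C' where "C' = A\<lparr>carrier := C\<rparr>"
  have C'_simps [simp]: "carrier C' = C" "\<zero>\<^bsub>C'\<^esub> = \<zero>\<^bsub>A\<^esub>" "\<one>\<^bsub>C'\<^esub> = \<one>\<^bsub>A\<^esub>" "mult C' = mult A" "add C' = add A"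
    by (auto simp: C'_def)
  have "subcring C A"
    using A.subcringI[OF CD(9)] commC CD(1) by simp
  then interpret C: cring C'
    unfolding C'_def using A.subcring_iff[OF CD(1)] by simp
  have idealM: "ideal M C'"
  proof (rule idealI)
    show "ring C'" by unfold_locales
    show "subgroup M (add_monoid C')"
    proof (rule C.add.subgroupI)
      show "\<ominus>\<^bsub>C'\<^esub> x \<in> M" if "x \<in> M" for x
      proof -
        have "x \<in> carrier C'" using that M(1) by auto
        then have "\<ominus>\<^bsub>C'\<^esub> x = (\<ominus>\<^bsub>C'\<^esub> \<one>\<^bsub>C'\<^esub>) \<otimes>\<^bsub>C'\<^esub> x" by (simp only: C.l_minus[OF C.one_closed] C.l_one)
        moreover have "\<ominus>\<^bsub>C'\<^esub> \<one>\<^bsub>C'\<^esub> \<in> carrier C'" by (rule C.a_inv_closed[OF C.one_closed])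
        ultimately show ?thesis using M(5) that by simp
      qed
    qed (use M in auto)
    show "x \<otimes>\<^bsub>C'\<^esub> a \<in> M" if "a \<in> M" "x \<in> carrier C'" for a x using that M(5) by simp
    show "a \<otimes>\<^bsub>C'\<^esub> x \<in> M" if "a \<in> M" "x \<in> carrier C'" for a x
      using that M(5)[of x a] commC[of a x] M(1) by auto
  qed
  then interpret M: ideal M C' .
  have "primeideal M C'"
  proof (rule primeidealI[OF idealM C.is_cring])
    show "carrier C' \<noteq> M" using M(3) CD(2) by auto
  qed (use M(6) in simp)
  then interpret M: primeideal M C' .
  define K where "K = C' Quot M"
  have dom: "domain K" unfolding K_def by (rule M.quotient_is_domain)
  interpret K: "domain" K by (rule dom)
  define \<pi> where "\<pi> x = M +>\<^bsub>C'\<^esub> x" for x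
  have \<pi>: "\<pi> \<in> Ring.ring_hom C' K"
    using M.rcos_ring_hom unfolding K_def \<pi>_def by simp
  have \<pi>_add: "\<pi> (x \<oplus>\<^bsub>A\<^esub> y) = \<pi> x \<oplus>\<^bsub>K\<^esub> \<pi> y" and \<pi>_mult: "\<pi> (x \<otimes>\<^bsub>A\<^esub> y) = \<pi> x \<otimes>\<^bsub>K\<^esub> \<pi> y"
    if "x \<in> C" "y \<in> C" for x y
    using ring_hom_add[OF \<pi>, of x y] ring_hom_mult[OF \<pi>, of x y] that by simp_all
  have \<pi>_one: "\<pi> \<one>\<^bsub>A\<^esub> = \<one>\<^bsub>K\<^esub>" using ring_hom_one[OF \<pi>] by simp
  have \<pi>_closed: "\<pi> x \<in> carrier K" if "x \<in> C" for x using ring_hom_closed[OF \<pi>] that by simp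
  have scal: "c \<odot>\<^bsub>A\<^esub> \<one>\<^bsub>A\<^esub> \<in> C" for c using CD(2,6) by simp
  define h where "h c = \<pi> (c \<odot>\<^bsub>A\<^esub> \<one>\<^bsub>A\<^esub>)" for c
  have h: "h \<in> Ring.ring_hom class_ring K"
  proof (rule ring_hom_memI)
    fix x y :: 'k
    show "h x \<in> carrier K" unfolding h_def by (rule \<pi>_closed[OF scal])
    have "(x * y) \<odot>\<^bsub>A\<^esub> \<one>\<^bsub>A\<^esub> = (x \<odot>\<^bsub>A\<^esub> \<one>\<^bsub>A\<^esub>) \<otimes>\<^bsub>A\<^esub> (y \<odot>\<^bsub>A\<^esub> \<one>\<^bsub>A\<^esub>)"
      using A.smult_eq_mult_one[of "y \<odot>\<^bsub>A\<^esub> \<one>\<^bsub>A\<^esub>" x] A.vs.smult_assoc1[of x y "\<one>\<^bsub>A\<^esub>"] by simp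
    then show "h (x \<otimes>\<^bsub>class_ring\<^esub> y) = h x \<otimes>\<^bsub>K\<^esub> h y"
      by (simp add: h_def \<pi>_mult[OF scal scal])
    show "h (x \<oplus>\<^bsub>class_ring\<^esub> y) = h x \<oplus>\<^bsub>K\<^esub> h y"
      by (simp add: h_def A.smult_l_distr' \<pi>_add[OF scal scal])
    show "h \<one>\<^bsub>class_ring\<^esub> = \<one>\<^bsub>K\<^esub>"
      using A.vs.smult_one[of "\<one>\<^bsub>A\<^esub>"] by (simp add: h_def \<pi>_one)
  qed
  have "\<exists>\<chi>\<in>Ring.ring_hom K class_ring. \<forall>c. \<chi> (h c) = c"
  proof (rule weak_nullstellensatz[OF dom h finite_imageI[OF X(1)]])
    show "\<pi> ` X \<subseteq> carrier K" using \<pi>_closed XC by auto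
    fix T assume T: "subring T K" "range h \<union> \<pi> ` X \<subseteq> T"
    \<comment> \<open>\<open>T\<close> is only a subring, but it contains \<open>range h\<close>.
      Its preimage is therefore closed under scalars, and being a subalgebra that contains
      \<open>X\<close> it is all of \<open>C\<close>.\<close>
    let ?S = "{c \<in> C. \<pi> c \<in> T}"
    have "subalgebra_of ?S A"
      unfolding A.subalgebra_of_iff
    proof (intro conjI ballI allI)
      show "c \<odot>\<^bsub>A\<^esub> w \<in> ?S" if "w \<in> ?S" for c w
      proof -
        have w: "w \<in> C" "\<pi> w \<in> T" "w \<in> carrier A" using that CD(1) by auto
        have "\<pi> (c \<odot>\<^bsub>A\<^esub> w) = h c \<otimes>\<^bsub>K\<^esub> \<pi> w"
          unfolding h_def A.smult_eq_mult_one[OF w(3), of c] using \<pi>_mult[OF scal w(1)] .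
        moreover have "h c \<in> T" using T(2) by blast
        ultimately show ?thesis using w CD(6) subringE(6)[OF T(1), of "h c" "\<pi> w"] by simp
      qed
    qed (use CD subringE[OF T(1)] \<pi>_one in \<open>auto simp: \<pi>_add \<pi>_mult\<close>)
    moreover have "X \<subseteq> ?S" using XC T(2) by auto
    ultimately have "C \<subseteq> ?S" unfolding C by (rule A.generated_subalgebra_least)
    then show "carrier K \<subseteq> T"
      by (auto simp: K_def FactRing_def A_RCOSETS_def' \<pi>_def)
  qed
  then obtain \<psi> where \<psi>: "\<psi> \<in> Ring.ring_hom K class_ring" "\<And>c. \<psi> (h c) = c" by auto
  have "\<psi> (\<pi> x) = 0" if "x \<in> M" for x
  proof -
    have "\<pi> x = \<zero>\<^bsub>K\<^esub>"
      unfolding \<pi>_def K_def FactRing_def using M.a_rcos_const[OF that] by simp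
    then show ?thesis using ring_hom_zero[OF \<psi>(1) K.ring_axioms class_ring.ring_axioms] by simp
  qed
  moreover have "\<psi> (\<pi> (x \<oplus>\<^bsub>A\<^esub> y)) = \<psi> (\<pi> x) + \<psi> (\<pi> y)" "\<psi> (\<pi> (x \<otimes>\<^bsub>A\<^esub> y)) = \<psi> (\<pi> x) * \<psi> (\<pi> y)"
    if "x \<in> C" "y \<in> C" for x y
    using that ring_hom_add[OF \<psi>(1), of "\<pi> x" "\<pi> y"] ring_hom_mult[OF \<psi>(1), of "\<pi> x" "\<pi> y"] \<pi>_closed
    by (simp_all add: \<pi>_add \<pi>_mult)
  moreover have "\<psi> (\<pi> (c \<odot>\<^bsub>A\<^esub> x)) = c * \<psi> (\<pi> x)" if "x \<in> C" for c x
  proof -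
    have "\<pi> (c \<odot>\<^bsub>A\<^esub> x) = h c \<otimes>\<^bsub>K\<^esub> \<pi> x"
      unfolding h_def A.smult_eq_mult_one[OF subsetD[OF CD(1) that], of c] using \<pi>_mult[OF scal that] .
    then show ?thesis
      using ring_hom_mult[OF \<psi>(1), of "h c" "\<pi> x"] ring_hom_closed[OF h, of c] \<pi>_closed[OF that] \<psi>(2) by simp
  qed
  moreover have "\<psi> (\<pi> \<one>\<^bsub>A\<^esub>) = 1"
    using ring_hom_one[OF \<psi>(1)] \<pi>_one by simp
  ultimately show ?thesis by (intro exI[of _ "\<lambda>x. \<psi> (\<pi> x)"]) simp
qed

section \<open>Irreducible modules over a pair of generating subalgebras\<close>

text \<open>Passing to the kernel of one functional costs at most one dimension. The subspace
  \<open>U\<close> varies in the induction because the remaining functionals are restricted to that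
  kernel. Building a spanning set gives finite-dimensionality and the bound together.\<close>

lemma edim_le_card_functionals:
  fixes W :: "('k :: field, 'w) module"
  assumes W: "vectorspace class_ring W" and I: "finite I"
    and add: "\<And>i v w. i \<in> I \<Longrightarrow> v \<in> carrier W \<Longrightarrow> w \<in> carrier W \<Longrightarrow> f i (v \<oplus>\<^bsub>W\<^esub> w) = f i v + f i w"
    and smult: "\<And>i c w. i \<in> I \<Longrightarrow> w \<in> carrier W \<Longrightarrow> f i (c \<odot>\<^bsub>W\<^esub> w) = c * (f i w :: 'k)"
    and ker: "\<And>w. w \<in> carrier W \<Longrightarrow> (\<And>i. i \<in> I \<Longrightarrow> f i w = 0) \<Longrightarrow> w = \<zero>\<^bsub>W\<^esub>"
  shows "edim W \<le> enat (card I)"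
proof -
  interpret W: vectorspace class_ring W by fact
  have main: "\<exists>S\<subseteq>U. finite S \<and> card S \<le> card J \<and> U \<subseteq> W.span S"
    if "finite J" "J \<subseteq> I" "VectorSpace.subspace class_ring U W"
      "\<And>w. w \<in> U \<Longrightarrow> (\<And>i. i \<in> J \<Longrightarrow> f i w = 0) \<Longrightarrow> w = \<zero>\<^bsub>W\<^esub>" for J U
    using that
  proof (induction J arbitrary: U rule: finite_induct)
    case empty
    then have "U \<subseteq> {\<zero>\<^bsub>W\<^esub>}" by auto
    then have "U \<subseteq> W.span {}" using W.span_is_submodule[of "{}"] by (auto simp: LinearCombinations.submodule_def)
    then show ?case by (intro exI[of _ "{}"]) simp
  next
    case (insert j J)
    note U = insert.prems(2)[unfolded subspace_iff[OF W]]
    let ?U = "{w \<in> U. f j w = 0}"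
    have j: "j \<in> I" using insert.prems by simp
    have f0: "f j \<zero>\<^bsub>W\<^esub> = 0"
      using smult[OF j W.M.zero_closed, of 0] W.smult_l_null[OF W.M.zero_closed] by simp
    have sub: "VectorSpace.subspace class_ring ?U W"
      unfolding subspace_iff[OF W] using U f0 add[OF j] smult[OF j] by (auto simp: subset_iff)
    have ker': "w = \<zero>\<^bsub>W\<^esub>" if "w \<in> ?U" "\<And>i. i \<in> J \<Longrightarrow> f i w = 0" for w
      using insert.prems(3)[of w] that by auto
    have JI: "J \<subseteq> I" using insert.prems(1) by simp
    obtain S where S: "S \<subseteq> ?U" "finite S" "card S \<le> card J" "?U \<subseteq> W.span S"
      using insert.IH[OF JI sub ker'] by blast
    show ?case
    proof (cases "?U = U")
      case True
      then show ?thesis using S insert.hyps by (intro exI[of _ S]) auto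
    next
      case False
      then obtain u where u: "u \<in> U" "f j u \<noteq> 0" by blast
      have SW: "insert u S \<subseteq> carrier W" using S(1) u U by auto
      have sp: "VectorSpace.subspace class_ring (W.span (insert u S)) W"
        by (rule W.span_is_subspace[OF SW])
      note sp' = sp[unfolded subspace_iff[OF W]]
      have mono: "W.span S \<subseteq> W.span (insert u S)" using W.span_is_monotone[of S "insert u S"] by auto
      have uS: "u \<in> W.span (insert u S)" using W.in_own_span[OF SW] by auto
      have "x \<in> W.span (insert u S)" if x: "x \<in> U" for x
      proof -
        \<comment> \<open>The scalar for which \<open>x - c u\<close> lies in the kernel of
          \<open>f j\<close>, where the induction hypothesis applies.\<close>
        define c where "c = f j x / f j u"
        have carr: "x \<in> carrier W" "u \<in> carrier W" "c \<odot>\<^bsub>W\<^esub> u \<in> carrier W" "(- c) \<odot>\<^bsub>W\<^esub> u \<in> carrier W" using x u U by auto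
        have "x \<oplus>\<^bsub>W\<^esub> (- c) \<odot>\<^bsub>W\<^esub> u \<in> ?U"
          using x u U carr add[OF j carr(1,4)] smult[OF j carr(2)] by (simp add: c_def)
        then have 1: "x \<oplus>\<^bsub>W\<^esub> (- c) \<odot>\<^bsub>W\<^esub> u \<in> W.span (insert u S)" using S(4) mono by blast
        have "(- c) \<odot>\<^bsub>W\<^esub> u \<oplus>\<^bsub>W\<^esub> c \<odot>\<^bsub>W\<^esub> u = \<zero>\<^bsub>W\<^esub>"
          using W.smult_l_distr[of "- c" c u] W.smult_l_null[of u] carr by simp
        then have "x = (x \<oplus>\<^bsub>W\<^esub> (- c) \<odot>\<^bsub>W\<^esub> u) \<oplus>\<^bsub>W\<^esub> c \<odot>\<^bsub>W\<^esub> u"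
          using carr by (simp add: W.M.a_assoc)
        then show ?thesis using sp' 1 uS by metis
      qed
      then show ?thesis
        using S u insert.hyps by (intro exI[of _ "insert u S"]) (auto simp: card_insert_if)
    qed
  qed
  have "VectorSpace.subspace class_ring (carrier W) W"
    using subspace_iff[OF W, of "carrier W"] by auto
  then obtain S where S: "S \<subseteq> carrier W" "finite S" "card S \<le> card I" "carrier W \<subseteq> W.span S"
    using main[OF I subset_refl, of "carrier W"] ker by meson
  have "W.span S \<subseteq> carrier W" using W.span_is_subset2[OF S(1)] .
  then have gen: "W.gen_set S" using S(4) by auto
  then have "W.fin_dim" unfolding W.fin_dim_def by (intro exI[of _ S] conjI S(1,2))
  moreover have "W.dim \<le> card S" by (rule W.gen_ge_dim[OF S(2,1) gen])
  ultimately show ?thesis using S(3) by (simp add: edim_def)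
qed

text \<open>Records what the argument takes from the partial abelianization: \<open>SA\<close> and
  \<open>SB\<close> stand for the images of \<open>A\<close> and \<open>B\<close>, and
  \<open>X\<close> for finitely many elements of \<open>V\<close>. Spanning is phrased as leastness
  among subspaces because it is applied to subspaces such as the zero set of
  \<open>x \<mapsto> \<phi> (\<rho> x v)\<close>.\<close>

locale irreducible_pair = unital_algebra Q
  for Q :: "('k :: {alg_closed_field, field_char_0}, 'q) module" (structure) +
  fixes SA SB :: "'q set" and X :: "('q \<times> 'q) set"
    and W :: "('k, 'w) module" and \<rho> :: "'q \<Rightarrow> 'w \<Rightarrow> 'w"
  assumes SA: "subalgebra_of SA Q" and SB: "subalgebra_of SB Q"
    and X: "finite X" "X \<subseteq> SA \<times> SB"
    and comm: "\<And>p q. p \<in> X \<Longrightarrow> q \<in> X \<Longrightarrow>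
      (fst p \<oplus> snd p) \<otimes> (fst q \<oplus> snd q) = (fst q \<oplus> snd q) \<otimes> (fst p \<oplus> snd p)"
    and spanA: "\<And>U. VectorSpace.subspace class_ring U Q \<Longrightarrow> insert \<one> (fst ` X) \<subseteq> U \<Longrightarrow> SA \<subseteq> U"
    and spanB: "\<And>U. VectorSpace.subspace class_ring U Q \<Longrightarrow> insert \<one> (snd ` X) \<subseteq> U \<Longrightarrow> SB \<subseteq> U"
    and gen: "\<And>T. subalgebra_of T Q \<Longrightarrow> SA \<union> SB \<subseteq> T \<Longrightarrow> carrier Q \<subseteq> T"
    and irr: "irreducible_representation Q W \<rho>"
begin

text \<open>The data are symmetric, since addition commutes, so the bound obtained from
  \<open>SA\<close> also holds with \<open>SB\<close>.\<close>

lemma swap: "irreducible_pair Q SB SA (prod.swap ` X) W \<rho>"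
proof (unfold_locales)
  show "subalgebra_of SB Q" "subalgebra_of SA Q" "irreducible_representation Q W \<rho>" "finite (prod.swap ` X)"
    "prod.swap ` X \<subseteq> SB \<times> SA"
    using SA SB irr X by auto
  have carr: "fst p \<in> carrier Q" "snd p \<in> carrier Q" if "p \<in> X" for p
    using subsetD[OF X(2) that] subsetD[OF subalgebraD(1)[OF SA]] subsetD[OF subalgebraD(1)[OF SB]] by auto
  show "(fst p \<oplus> snd p) \<otimes> (fst q \<oplus> snd q) = (fst q \<oplus> snd q) \<otimes> (fst p \<oplus> snd p)"
    if "p \<in> prod.swap ` X" "q \<in> prod.swap ` X" for p q
  proof -
    from that obtain p' q' where pq: "p' \<in> X" "q' \<in> X" "p = prod.swap p'" "q = prod.swap q'" by blast
    then show ?thesis using comm[OF pq(1,2)] carr[OF pq(1)] carr[OF pq(2)] by (simp add: a_comm)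
  qed
  show "SB \<subseteq> U" if "VectorSpace.subspace class_ring U Q" "insert \<one> (fst ` prod.swap ` X) \<subseteq> U" for U
    using spanB[OF that(1)] that(2) by (simp add: image_image)
  show "SA \<subseteq> U" if "VectorSpace.subspace class_ring U Q" "insert \<one> (snd ` prod.swap ` X) \<subseteq> U" for U
    using spanA[OF that(1)] that(2) by (simp add: image_image)
  show "carrier Q \<subseteq> T" if "subalgebra_of T Q" "SB \<union> SA \<subseteq> T" for T
    using gen[OF that(1)] that(2) by auto
qed

definition pair_sums :: "'q set" where "pair_sums = (\<lambda>p. fst p \<oplus> snd p) ` X"

definition C :: "'q set" where "C = generated_subalgebra Q pair_sums"

lemmas SA_D = subalgebraD[OF SA] and SB_D = subalgebraD[OF SB]

lemma pair_carrier: "p \<in> X \<Longrightarrow> fst p \<in> SA" "p \<in> X \<Longrightarrow> snd p \<in> SB"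
  using X by auto

lemma SA_carrier [simp]: "a \<in> SA \<Longrightarrow> a \<in> carrier Q" and SB_carrier [simp]: "b \<in> SB \<Longrightarrow> b \<in> carrier Q"
  using SA_D(1) SB_D(1) by auto

lemma pair_sums_carrier: "pair_sums \<subseteq> carrier Q"
  using pair_carrier by (fastforce simp: pair_sums_def)

lemma C_alg: "subalgebra_of C Q" and pair_sums_C: "pair_sums \<subseteq> C"
  using generated_subalgebra[OF pair_sums_carrier] by (simp_all add: C_def)

lemma pair_sum_C: "p \<in> X \<Longrightarrow> fst p \<oplus> snd p \<in> C"
  using pair_sums_C unfolding pair_sums_def by blast

lemmas C_D = subalgebraD[OF C_alg]

lemma C_carrier [simp]: "c \<in> C \<Longrightarrow> c \<in> carrier Q" using C_D(1) by auto

lemma C_comm: "c \<in> C \<Longrightarrow> d \<in> C \<Longrightarrow> c \<otimes> d = d \<otimes> c"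
  unfolding C_def
  by (rule generated_subalgebra_commute[OF pair_sums_carrier]) (unfold pair_sums_def, blast dest: comm)

text \<open>This is \<open>C SA\<close>, the left \<open>C\<close>-submodule generated by
  \<open>SA\<close>. Elements of \<open>C\<close> and \<open>SA\<close> need not commute, so closure
  under products has to be earned by moving factors from \<open>C\<close> to the left past
  \<open>SA\<close>.\<close>

inductive_set sweep :: "'q set" where
  base: "a \<in> SA \<Longrightarrow> a \<in> sweep"
| add: "x \<in> sweep \<Longrightarrow> y \<in> sweep \<Longrightarrow> x \<oplus> y \<in> sweep"
| smult: "x \<in> sweep \<Longrightarrow> c \<odot> x \<in> sweep"
| left: "c \<in> C \<Longrightarrow> x \<in> sweep \<Longrightarrow> c \<otimes> x \<in> sweep"

lemma sweep_carrier [simp]: "x \<in> sweep \<Longrightarrow> x \<in> carrier Q"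
  by (induction rule: sweep.induct) auto

lemma sweep_subspace: "VectorSpace.subspace class_ring sweep Q"
  unfolding subspace_alg_iff by (auto intro: sweep.intros SA_D(3))

lemma sweep_right_SA: "x \<in> sweep \<Longrightarrow> a \<in> SA \<Longrightarrow> x \<otimes> a \<in> sweep"
  by (induction rule: sweep.induct)
    (auto simp: l_distr smult_mult_left[symmetric] m_assoc intro: sweep.intros SA_D(5))

lemma SB_sweep: "b \<in> SB \<Longrightarrow> b \<in> sweep"
proof -
  have "snd p \<in> sweep" if p: "p \<in> X" for p
  proof -
    have [simp]: "fst p \<in> SA" "snd p \<in> SB" using pair_carrier p by auto
    have "(fst p \<oplus> snd p) \<otimes> \<one> \<in> sweep"
      by (intro sweep.left sweep.base pair_sum_C p SA_D(2))
    then have "(fst p \<oplus> snd p) \<ominus> fst p \<in> sweep"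
      by (intro subspace_minus[OF sweep_subspace]) (auto intro: sweep.base)
    moreover have "(fst p \<oplus> snd p) \<ominus> fst p = snd p"
      by (simp add: minus_eq a_comm[of "fst p"] a_assoc r_neg)
    ultimately show ?thesis by simp
  qed
  then have "SB \<subseteq> sweep"
    using SA_D(2) by (intro spanB[OF sweep_subspace]) (auto intro: sweep.base)
  then show "b \<in> SB \<Longrightarrow> b \<in> sweep" by auto
qed

lemma SA_sum_sweep:
  assumes p: "p \<in> X" and a: "a \<in> SA"
  shows "a \<otimes> (fst p \<oplus> snd p) \<in> sweep"
proof -
  let ?q = "fst p \<oplus> snd p"
  have [simp]: "fst p \<in> SA" "snd p \<in> SB" using pair_carrier p by auto
  have one: "\<one> \<in> sweep" using SA_D(2) by (rule sweep.base)
  let ?U = "{a \<in> carrier Q. a \<otimes> ?q \<in> sweep}"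
  have "VectorSpace.subspace class_ring ?U Q"
    using sweep_subspace unfolding subspace_alg_iff
    by (auto simp: l_distr smult_mult_left[symmetric])
  moreover have "insert \<one> (fst ` X) \<subseteq> ?U"
  proof -
    have "\<one> \<in> ?U" using sweep.left[OF pair_sum_C[OF p] one] by simp
    moreover have "fst r \<in> ?U" if r: "r \<in> X" for r
    proof -
      have [simp]: "fst r \<in> SA" "snd r \<in> SB" using pair_carrier r by auto
      let ?r = "fst r \<oplus> snd r"
      have "?r \<otimes> ?q \<in> sweep" using sweep.left[OF pair_sum_C[OF r] sweep.left[OF pair_sum_C[OF p] one]] by simp
      \<comment> \<open>\<open>snd r \<otimes> fst p\<close> is covered because \<open>sweep\<close>
        contains \<open>SB\<close> and admits right factors from \<open>SA\<close>;
        \<open>snd r \<otimes> snd p\<close> is covered because \<open>SB\<close> is closed under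
        products.\<close>
      moreover have "snd r \<otimes> ?q \<in> sweep"
        using sweep.add[OF sweep_right_SA[OF SB_sweep, of "snd r" "fst p"] SB_sweep[OF SB_D(5), of "snd r" "snd p"]]
        by (simp add: r_distr)
      ultimately have "?r \<otimes> ?q \<ominus> snd r \<otimes> ?q \<in> sweep"
        by (rule subspace_minus[OF sweep_subspace])
      moreover have "?r \<otimes> ?q \<ominus> snd r \<otimes> ?q = fst r \<otimes> ?q"
        by (simp add: minus_eq l_distr[of "fst r" "snd r" ?q] a_assoc r_neg)
      ultimately show ?thesis by simp
    qed
    ultimately show ?thesis by auto
  qed
  ultimately show ?thesis using spanA a by blast
qed

text \<open>The elements whose right multiplication preserves \<open>sweep\<close> form a
  subalgebra, so the generators \<open>q\<close> of \<open>C\<close> suffice. For these,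
  associativity moves \<open>q\<close> inside \<open>c \<otimes> x\<close> until it meets an element
  of \<open>SA\<close>.\<close>

lemma sweep_right_C:
  assumes "c \<in> C" "x \<in> sweep"
  shows "x \<otimes> c \<in> sweep"
proof -
  let ?T = "{c \<in> carrier Q. \<forall>x\<in>sweep. x \<otimes> c \<in> sweep}"
  have "C \<subseteq> ?T"
    unfolding C_def
  proof (rule generated_subalgebra_least)
    show "subalgebra_of ?T Q"
      unfolding subalgebra_of_iff
      by (auto simp: r_distr smult_mult_right[symmetric] m_assoc[symmetric] intro: sweep.intros)
    show "pair_sums \<subseteq> ?T"
    proof
      fix q assume "q \<in> pair_sums"
      then obtain p where p: "p \<in> X" "q = fst p \<oplus> snd p" unfolding pair_sums_def by blast
      have [simp]: "q \<in> carrier Q" using \<open>q \<in> pair_sums\<close> pair_sums_carrier by auto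
      have "x \<otimes> q \<in> sweep" if "x \<in> sweep" for x
        using that
      proof (induction rule: sweep.induct)
        case (base a)
        then show ?case using SA_sum_sweep[OF p(1)] p(2) by simp
      qed (auto simp: l_distr smult_mult_left[symmetric] m_assoc intro: sweep.intros)
      then show "q \<in> ?T" by simp
    qed
  qed
  with assms show ?thesis by auto
qed

text \<open>The induction is on the right factor with the left one arbitrary: in
  \<open>x (c y) = (x c) y\<close> the left factor changes, and \<open>sweep_right_C\<close> keeps
  it in \<open>sweep\<close>.\<close>

lemma sweep_mult: "y \<in> sweep \<Longrightarrow> x \<in> sweep \<Longrightarrow> x \<otimes> y \<in> sweep"
proof (induction arbitrary: x rule: sweep.induct)
  case (left c y)
  have "(x \<otimes> c) \<otimes> y \<in> sweep" by (rule left.IH[OF sweep_right_C[OF left.hyps(1) left.prems]])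
  then show ?case using left by (simp add: m_assoc)
qed (auto simp: r_distr smult_mult_right[symmetric] intro: sweep.intros sweep_right_SA)

lemma carrier_subset_sweep: "carrier Q \<subseteq> sweep"
proof (rule gen)
  show "subalgebra_of sweep Q"
    unfolding subalgebra_of_iff using SA_D(2) by (auto intro: sweep.intros sweep_mult)
qed (auto intro: sweep.base SB_sweep)

lemma left_module_generation:
  assumes D: "VectorSpace.subspace class_ring D Q" "SA \<subseteq> D"
    and left: "\<And>c x. c \<in> C \<Longrightarrow> x \<in> D \<Longrightarrow> c \<otimes> x \<in> D"
  shows "carrier Q \<subseteq> D"
proof -
  have "x \<in> D" if "x \<in> sweep" for x
    using that D left by (induction rule: sweep.induct) (auto simp: subspace_alg_iff)
  then show ?thesis using carrier_subset_sweep by auto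
qed

section \<open>The irreducible module and the action on it\<close>

lemma rep: "representation Q W \<rho>" and W_nonzero: "carrier W \<noteq> {\<zero>\<^bsub>W\<^esub>}"
  and irrD: "VectorSpace.subspace class_ring U W \<Longrightarrow> (\<And>x. x \<in> carrier Q \<Longrightarrow> \<rho> x ` U \<subseteq> U) \<Longrightarrow>
     U = {\<zero>\<^bsub>W\<^esub>} \<or> U = carrier W"
  using irr unfolding irreducible_representation_def by auto

lemma vs_W: "vectorspace class_ring W"
  using rep by (simp add: representation_def)

sublocale W: vectorspace class_ring W by (rule vs_W)

lemmas subspace_W_iff = subspace_iff[OF vs_W]

lemma rho_hom: "x \<in> carrier Q \<Longrightarrow> \<rho> x \<in> module_hom class_ring W W"
  using rep by (simp add: representation_def)

lemma rho_closed [simp]: "x \<in> carrier Q \<Longrightarrow> w \<in> carrier W \<Longrightarrow> \<rho> x w \<in> carrier W"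
  using module_hom_closed[OF rho_hom] by blast

lemma rho_vadd: "x \<in> carrier Q \<Longrightarrow> v \<in> carrier W \<Longrightarrow> w \<in> carrier W \<Longrightarrow> \<rho> x (v \<oplus>\<^bsub>W\<^esub> w) = \<rho> x v \<oplus>\<^bsub>W\<^esub> \<rho> x w"
  by (rule module_hom_add[OF rho_hom])

lemma rho_vsmult: "x \<in> carrier Q \<Longrightarrow> w \<in> carrier W \<Longrightarrow> \<rho> x (c \<odot>\<^bsub>W\<^esub> w) = c \<odot>\<^bsub>W\<^esub> \<rho> x w"
  using module_hom_smult[OF rho_hom, of x c w] by simp

lemma rho_one [simp]: "w \<in> carrier W \<Longrightarrow> \<rho> \<one> w = w"
  and rho_mult: "x \<in> carrier Q \<Longrightarrow> y \<in> carrier Q \<Longrightarrow> w \<in> carrier W \<Longrightarrow> \<rho> (x \<otimes> y) w = \<rho> x (\<rho> y w)"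
  and rho_add: "x \<in> carrier Q \<Longrightarrow> y \<in> carrier Q \<Longrightarrow> w \<in> carrier W \<Longrightarrow> \<rho> (x \<oplus> y) w = \<rho> x w \<oplus>\<^bsub>W\<^esub> \<rho> y w"
  and rho_smult: "x \<in> carrier Q \<Longrightarrow> w \<in> carrier W \<Longrightarrow> \<rho> (c \<odot> x) w = c \<odot>\<^bsub>W\<^esub> \<rho> x w"
  using rep by (simp_all add: representation_def)

lemma W_smult_closed [simp]: "w \<in> carrier W \<Longrightarrow> c \<odot>\<^bsub>W\<^esub> w \<in> carrier W"
  using W.smult_closed by simp

lemma W_smult_0 [simp]: "w \<in> carrier W \<Longrightarrow> 0 \<odot>\<^bsub>W\<^esub> w = \<zero>\<^bsub>W\<^esub>"
  using W.smult_l_null[of w] by simp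

lemma W_smult_zero [simp]: "c \<odot>\<^bsub>W\<^esub> \<zero>\<^bsub>W\<^esub> = \<zero>\<^bsub>W\<^esub>"
  using W.smult_r_null[of c] by simp

lemma W_smult_r_distr: "v \<in> carrier W \<Longrightarrow> w \<in> carrier W \<Longrightarrow> c \<odot>\<^bsub>W\<^esub> (v \<oplus>\<^bsub>W\<^esub> w) = c \<odot>\<^bsub>W\<^esub> v \<oplus>\<^bsub>W\<^esub> c \<odot>\<^bsub>W\<^esub> w"
  using W.smult_r_distr[of c v w] by simp

lemma rho_zero [simp]: "w \<in> carrier W \<Longrightarrow> \<rho> \<zero> w = \<zero>\<^bsub>W\<^esub>"
  using rho_smult[of \<one> w 0] smult_zero_left[of \<one>] by simp

lemma rho_vzero [simp]: "x \<in> carrier Q \<Longrightarrow> \<rho> x \<zero>\<^bsub>W\<^esub> = \<zero>\<^bsub>W\<^esub>"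
  using rho_vsmult[of x "\<zero>\<^bsub>W\<^esub>" 0] by simp

lemma orbit_subspace:
  assumes "VectorSpace.subspace class_ring U W" "w \<in> carrier W"
  shows "VectorSpace.subspace class_ring {x \<in> carrier Q. \<rho> x w \<in> U} Q"
  using assms unfolding subspace_alg_iff subspace_W_iff by (auto simp: rho_add rho_smult)

lemma stabilizer_subalgebra:
  assumes "VectorSpace.subspace class_ring U W"
  shows "subalgebra_of {x \<in> carrier Q. \<forall>w\<in>U. \<rho> x w \<in> U} Q"
  using assms unfolding subalgebra_of_iff subspace_W_iff
  by (auto simp: rho_add rho_smult rho_mult subset_iff)

section \<open>Subspaces stable under the commutative subalgebra\<close>

definition C_stable :: "'w set \<Rightarrow> bool" where
  "C_stable U \<longleftrightarrow> VectorSpace.subspace class_ring U W \<and> (\<forall>c\<in>C. \<forall>w\<in>U. \<rho> c w \<in> U)"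

lemma C_stableD:
  assumes "C_stable U"
  shows "U \<subseteq> carrier W" "u \<in> U \<Longrightarrow> u \<in> carrier W" "\<zero>\<^bsub>W\<^esub> \<in> U" "v \<in> U \<Longrightarrow> w \<in> U \<Longrightarrow> v \<oplus>\<^bsub>W\<^esub> w \<in> U"
    "w \<in> U \<Longrightarrow> c \<odot>\<^bsub>W\<^esub> w \<in> U" "d \<in> C \<Longrightarrow> w \<in> U \<Longrightarrow> \<rho> d w \<in> U"
  using assms unfolding C_stable_def subspace_W_iff by auto

text \<open>This is finite generation of \<open>W\<close> over \<open>C\<close>, in the form that
  the chain argument uses. The elements \<open>x\<close> with \<open>\<rho> x w0\<close> in
  \<open>U\<close> form a left \<open>C\<close>-stable subspace containing \<open>SA\<close>, hence
  are all of \<open>Q\<close>; and the orbit of \<open>w0\<close> is \<open>W\<close> by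
  irreducibility.\<close>

lemma C_stable_cofinite:
  assumes w0: "w0 \<in> carrier W" "w0 \<noteq> \<zero>\<^bsub>W\<^esub>" and U: "C_stable U"
    and sub: "(\<lambda>e. \<rho> e w0) ` insert \<one> (fst ` X) \<subseteq> U"
  shows "U = carrier W"
proof -
  let ?D = "{x \<in> carrier Q. \<rho> x w0 \<in> U}"
  have D: "VectorSpace.subspace class_ring ?D Q"
    using orbit_subspace U w0 unfolding C_stable_def by blast
  have SAD: "SA \<subseteq> ?D"
  proof (rule spanA[OF D], rule subsetI)
    fix e assume e: "e \<in> insert \<one> (fst ` X)"
    have "\<rho> e w0 \<in> U" by (rule subsetD[OF sub imageI[OF e]])
    moreover have "e \<in> SA" using e pair_carrier(1) SA_D(2) by blast
    ultimately show "e \<in> ?D" by simp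
  qed
  have "carrier Q \<subseteq> ?D"
    by (rule left_module_generation[OF D SAD])
      (use w0 C_stableD(6)[OF U] in \<open>auto simp: rho_mult\<close>)
  then have orbit: "(\<lambda>x. \<rho> x w0) ` carrier Q \<subseteq> U" by auto
  have sub_orbit: "VectorSpace.subspace class_ring ((\<lambda>x. \<rho> x w0) ` carrier Q) W"
    unfolding subspace_W_iff
  proof (intro conjI ballI allI)
    show "\<zero>\<^bsub>W\<^esub> \<in> (\<lambda>x. \<rho> x w0) ` carrier Q"
      by (rule image_eqI[of _ _ \<zero>]) (use w0 in auto)
    fix v w assume "v \<in> (\<lambda>x. \<rho> x w0) ` carrier Q" "w \<in> (\<lambda>x. \<rho> x w0) ` carrier Q"
    then obtain x y where "x \<in> carrier Q" "y \<in> carrier Q" "v = \<rho> x w0" "w = \<rho> y w0" by auto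
    then show "v \<oplus>\<^bsub>W\<^esub> w \<in> (\<lambda>x. \<rho> x w0) ` carrier Q"
      by (intro image_eqI[of _ _ "x \<oplus> y"]) (use w0 in \<open>auto simp: rho_add\<close>)
  next
    fix c w assume "w \<in> (\<lambda>x. \<rho> x w0) ` carrier Q"
    then obtain y where "y \<in> carrier Q" "w = \<rho> y w0" by auto
    then show "c \<odot>\<^bsub>W\<^esub> w \<in> (\<lambda>x. \<rho> x w0) ` carrier Q"
      by (intro image_eqI[of _ _ "c \<odot> y"]) (use w0 in \<open>auto simp: rho_smult\<close>)
  qed (use w0 in auto)
  have stab_orbit: "\<rho> x ` (\<lambda>x. \<rho> x w0) ` carrier Q \<subseteq> (\<lambda>x. \<rho> x w0) ` carrier Q" if "x \<in> carrier Q" for x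
    using that w0 by (auto simp: rho_mult[symmetric])
  have "w0 \<in> (\<lambda>x. \<rho> x w0) ` carrier Q"
    by (rule image_eqI[of _ _ \<one>]) (use w0 in auto)
  then have "(\<lambda>x. \<rho> x w0) ` carrier Q = carrier W"
    using irrD[OF sub_orbit stab_orbit] w0(2) by (metis singletonD)
  with orbit show ?thesis using C_stableD(1)[OF U] by auto
qed

lemma nonzero_vector: "\<exists>w. w \<in> carrier W \<and> w \<noteq> \<zero>\<^bsub>W\<^esub>"
  using W_nonzero W.M.zero_closed by auto

lemma maximal_C_stable:
  "\<exists>U. C_stable U \<and> U \<noteq> carrier W \<and> (\<forall>U'. C_stable U' \<and> U \<subseteq> U' \<longrightarrow> U' = U \<or> U' = carrier W)"
proof -
  obtain w0 where w0: "w0 \<in> carrier W" "w0 \<noteq> \<zero>\<^bsub>W\<^esub>" using nonzero_vector by blast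
  let ?\<A> = "{U. C_stable U \<and> U \<noteq> carrier W}"
  let ?E = "(\<lambda>e. \<rho> e w0) ` insert \<one> (fst ` X)"
  have "\<exists>M\<in>?\<A>. \<forall>X\<in>?\<A>. M \<subseteq> X \<longrightarrow> X = M"
  proof (rule subset_Zorn_nonempty)
    have "C_stable {\<zero>\<^bsub>W\<^esub>}"
      unfolding C_stable_def subspace_W_iff by auto
    then have "{\<zero>\<^bsub>W\<^esub>} \<in> ?\<A>" using W_nonzero by auto
    then show "?\<A> \<noteq> {}" by blast
    fix \<C> assume ne: "\<C> \<noteq> {}" and chain: "subset.chain ?\<A> \<C>"
    have mem: "C_stable U" "U \<noteq> carrier W" if "U \<in> \<C>" for U
      using chain that unfolding subset.chain_def by auto
    have two: "\<exists>U\<in>\<C>. v \<in> U \<and> w \<in> U" if "v \<in> \<Union>\<C>" "w \<in> \<Union>\<C>" for v w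
      using chain that unfolding subset_chain_def by blast
    have stab: "C_stable (\<Union>\<C>)"
      unfolding C_stable_def subspace_W_iff
    proof (intro conjI ballI allI)
      show "\<Union>\<C> \<subseteq> carrier W" using C_stableD(1)[OF mem(1)] by blast
      show "\<zero>\<^bsub>W\<^esub> \<in> \<Union>\<C>" using C_stableD(3)[OF mem(1)] ne by blast
      show "v \<oplus>\<^bsub>W\<^esub> w \<in> \<Union>\<C>" if "v \<in> \<Union>\<C>" "w \<in> \<Union>\<C>" for v w
        using two[OF that] C_stableD(4)[OF mem(1)] by blast
      show "c \<odot>\<^bsub>W\<^esub> w \<in> \<Union>\<C>" if "w \<in> \<Union>\<C>" for c w
        using that C_stableD(5)[OF mem(1)] by blast
      show "\<rho> c w \<in> \<Union>\<C>" if "c \<in> C" "w \<in> \<Union>\<C>" for c w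
        using that C_stableD(6)[OF mem(1)] by blast
    qed
    \<comment> \<open>If the union were everything, one member of the chain would already contain
      the finitely many generators of \<open>W\<close> over \<open>C\<close>, and would not be
      proper.\<close>
    have "\<Union>\<C> \<noteq> carrier W"
    proof
      assume eq: "\<Union>\<C> = carrier W"
      have "?E \<subseteq> \<Union>\<C>" unfolding eq using w0 pair_carrier by auto
      moreover have "finite ?E" using X(1) by simp
      ultimately obtain U where U: "U \<in> \<C>" "?E \<subseteq> U"
        using finite_subset_Union_chain[OF _ _ ne chain] by metis
      then show False using C_stable_cofinite[OF w0 mem(1)[OF U(1)] U(2)] mem(2)[OF U(1)] by simp
    qed
    with stab show "\<Union>\<C> \<in> ?\<A>" by simp
  qed
  then show ?thesis by blast
qed

text \<open>Modulo a maximal \<open>U\<close> the module is simple over \<open>C\<close>, hence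
  generated by each nonzero class: \<open>U + C v\<close> is stable and strictly larger than
  \<open>U\<close>.\<close>

lemma maximal_cyclic:
  assumes U: "C_stable U" "\<And>U'. C_stable U' \<Longrightarrow> U \<subseteq> U' \<Longrightarrow> U' = U \<or> U' = carrier W"
    and v: "v \<in> carrier W" "v \<notin> U" and w: "w \<in> carrier W"
  shows "\<exists>c\<in>C. \<exists>u\<in>U. w = u \<oplus>\<^bsub>W\<^esub> \<rho> c v"
proof -
  note UD = C_stableD[OF U(1)]
  let ?U = "{u \<oplus>\<^bsub>W\<^esub> \<rho> c v | u c. u \<in> U \<and> c \<in> C}"
  have stab: "C_stable ?U"
    unfolding C_stable_def subspace_W_iff
  proof (intro conjI ballI allI)
    show "?U \<subseteq> carrier W" using UD(2) v by auto
    have "\<zero>\<^bsub>W\<^esub> = \<zero>\<^bsub>W\<^esub> \<oplus>\<^bsub>W\<^esub> \<rho> \<zero> v" using v by simp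
    then show "\<zero>\<^bsub>W\<^esub> \<in> ?U" using UD(3) C_D(3) by blast
    fix x assume "x \<in> ?U"
    then obtain u c where x: "x = u \<oplus>\<^bsub>W\<^esub> \<rho> c v" "u \<in> U" "c \<in> C" by blast
    have [simp]: "u \<in> carrier W" "c \<in> carrier Q" using x UD(2) by auto
    show "d \<odot>\<^bsub>W\<^esub> x \<in> ?U" for d
    proof -
      have "d \<odot>\<^bsub>W\<^esub> x = d \<odot>\<^bsub>W\<^esub> u \<oplus>\<^bsub>W\<^esub> \<rho> (d \<odot> c) v"
        using v by (simp add: x(1) W_smult_r_distr rho_smult)
      then show ?thesis using UD(5)[OF x(2)] C_D(6)[OF x(3)] by blast
    qed
    show "\<rho> d x \<in> ?U" if d: "d \<in> C" for d
    proof -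
      have "\<rho> d x = \<rho> d u \<oplus>\<^bsub>W\<^esub> \<rho> (d \<otimes> c) v"
        using v d by (simp add: x(1) rho_vadd rho_mult)
      then show ?thesis using UD(6)[OF d x(2)] C_D(5)[OF d x(3)] by blast
    qed
    fix y assume "y \<in> ?U"
    then obtain u' c' where y: "y = u' \<oplus>\<^bsub>W\<^esub> \<rho> c' v" "u' \<in> U" "c' \<in> C" by blast
    have [simp]: "u' \<in> carrier W" "c' \<in> carrier Q" using y UD(2) by auto
    have "x \<oplus>\<^bsub>W\<^esub> y = (u \<oplus>\<^bsub>W\<^esub> u') \<oplus>\<^bsub>W\<^esub> \<rho> (c \<oplus> c') v"
      using v by (simp add: x(1) y(1) rho_add W.M.a_ac)
    then show "x \<oplus>\<^bsub>W\<^esub> y \<in> ?U" using UD(4)[OF x(2) y(2)] C_D(4)[OF x(3) y(3)] by blast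
  qed
  have UU: "U \<subseteq> ?U"
  proof
    fix u assume u: "u \<in> U"
    then have "u = u \<oplus>\<^bsub>W\<^esub> \<rho> \<zero> v" using UD(2) v by simp
    then show "u \<in> ?U" using u C_D(3) by blast
  qed
  have vU: "v \<in> ?U"
  proof -
    have "v = \<zero>\<^bsub>W\<^esub> \<oplus>\<^bsub>W\<^esub> \<rho> \<one> v" using v by simp
    then show ?thesis using UD(3) C_D(2) by blast
  qed
  have "?U = carrier W"
    using U(2)[OF stab UU]
  proof
    assume eq: "?U = U"
    from vU have "v \<in> U" unfolding eq .
    with v(2) show ?thesis by simp
  qed
  with w have "w \<in> ?U" by simp
  then show ?thesis by blast
qed

text \<open>For \<open>w\<close> outside a maximal \<open>U\<close>, the map
  \<open>c \<mapsto> \<rho> c w\<close> identifies \<open>C\<close> modulo \<open>M\<close> with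
  \<open>W\<close> modulo \<open>U\<close>. The functional is the projection of \<open>W\<close> to
  this quotient followed by the character that kills \<open>M\<close>; its value at \<open>w\<close>
  is the value of the character at the unit.\<close>

lemma eigenfunctional:
  "\<exists>\<phi> \<chi> w. w \<in> carrier W \<and> \<phi> w = (1 :: 'k) \<and>
     (\<forall>v\<in>carrier W. \<forall>w\<in>carrier W. \<phi> (v \<oplus>\<^bsub>W\<^esub> w) = \<phi> v + \<phi> w) \<and>
     (\<forall>c. \<forall>w\<in>carrier W. \<phi> (c \<odot>\<^bsub>W\<^esub> w) = c * \<phi> w) \<and>
     (\<forall>c\<in>C. \<forall>w\<in>carrier W. \<phi> (\<rho> c w) = \<chi> c * \<phi> w)"
proof -
  obtain U where U: "C_stable U" "U \<noteq> carrier W"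
    and max: "\<And>U'. C_stable U' \<Longrightarrow> U \<subseteq> U' \<Longrightarrow> U' = U \<or> U' = carrier W"
    using maximal_C_stable by blast
  note UD = C_stableD[OF U(1)]
  note cyc = maximal_cyclic[OF U(1) max]
  obtain w where w: "w \<in> carrier W" "w \<notin> U" using U(2) UD(1) by blast
  define M where "M = {c \<in> C. \<rho> c w \<in> U}"
  have "\<exists>\<chi>. \<chi> \<one> = 1 \<and> (\<forall>x\<in>C. \<forall>y\<in>C. \<chi> (x \<oplus> y) = \<chi> x + \<chi> y) \<and>
    (\<forall>x\<in>C. \<forall>y\<in>C. \<chi> (x \<otimes> y) = \<chi> x * \<chi> y) \<and>
    (\<forall>c. \<forall>x\<in>C. \<chi> (c \<odot> x) = c * \<chi> x) \<and> (\<forall>x\<in>M. \<chi> x = (0 :: 'k))"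
  proof (rule character_of_generated[OF _ _ pair_sums_carrier _ C_def])
    show "unital_algebra Q" by unfold_locales
    show "finite pair_sums" using X(1) by (simp add: pair_sums_def)
    show "x \<otimes> y = y \<otimes> x" if "x \<in> pair_sums" "y \<in> pair_sums" for x y
      using C_comm that pair_sums_C by blast
    show "M \<subseteq> C" "\<zero> \<in> M" "\<one> \<notin> M"
      using w UD(3) C_D(3) by (auto simp: M_def)
    show "x \<oplus> y \<in> M" if "x \<in> M" "y \<in> M" for x y
      using that w UD(4) C_D(4) by (simp add: M_def rho_add)
    show "c \<otimes> x \<in> M" if "c \<in> C" "x \<in> M" for c x
      using that w UD(6) C_D(5) by (simp add: M_def rho_mult)
    \<comment> \<open>If \<open>y w\<close> is outside \<open>U\<close>, it generates the quotient,
      so \<open>w\<close> equals \<open>c y w\<close> modulo \<open>U\<close> for some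
      \<open>c\<close>. By commutativity \<open>x w\<close> then equals \<open>c (x y w)\<close>
      modulo \<open>U\<close>, which is zero there.\<close>
    show "x \<in> M \<or> y \<in> M" if x: "x \<in> C" and y: "y \<in> C" and xy: "x \<otimes> y \<in> M" for x y
    proof (rule disjCI)
      assume "y \<notin> M"
      have v: "\<rho> y w \<in> carrier W" "\<rho> y w \<notin> U" using \<open>y \<notin> M\<close> y w by (auto simp: M_def)
      obtain c u where c: "c \<in> C" "u \<in> U" "w = u \<oplus>\<^bsub>W\<^esub> \<rho> c (\<rho> y w)"
        using cyc[OF _ _ v w(1)] by blast
      have "\<rho> x (\<rho> c (\<rho> y w)) = \<rho> ((x \<otimes> c) \<otimes> y) w"
        using x y c w by (simp add: rho_mult)
      also have "(x \<otimes> c) \<otimes> y = c \<otimes> (x \<otimes> y)"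
        using x y c C_comm[OF x c(1)] by (simp add: m_assoc)
      also have "\<rho> \<dots> w = \<rho> c (\<rho> (x \<otimes> y) w)"
        using x y c w by (simp add: rho_mult)
      finally have "\<rho> x (\<rho> c (\<rho> y w)) \<in> U" using UD(6)[OF c(1)] xy by (simp add: M_def)
      then have "\<rho> x u \<oplus>\<^bsub>W\<^esub> \<rho> x (\<rho> c (\<rho> y w)) \<in> U" using UD(4) UD(6)[OF x c(2)] by blast
      moreover have "\<rho> x w = \<rho> x u \<oplus>\<^bsub>W\<^esub> \<rho> x (\<rho> c (\<rho> y w))"
        using arg_cong[OF c(3), of "\<rho> x"] rho_vadd[of x u "\<rho> c (\<rho> y w)"] x y c w UD(2) by simp
      ultimately show "x \<in> M" using x by (simp add: M_def)
    qed
  qed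
  then obtain \<chi> where \<chi>: "\<chi> \<one> = 1" "\<And>x y. x \<in> C \<Longrightarrow> y \<in> C \<Longrightarrow> \<chi> (x \<oplus> y) = \<chi> x + \<chi> y"
    "\<And>x y. x \<in> C \<Longrightarrow> y \<in> C \<Longrightarrow> \<chi> (x \<otimes> y) = \<chi> x * \<chi> y"
    "\<And>c x. x \<in> C \<Longrightarrow> \<chi> (c \<odot> x) = c * \<chi> x" "\<And>x. x \<in> M \<Longrightarrow> \<chi> x = (0 :: 'k)"
    by blast
  \<comment> \<open>\<open>R v c\<close> says that \<open>v\<close> and \<open>c w\<close> have the
    same class modulo \<open>U\<close>. Such a \<open>c\<close> exists by cyclicity and is
    determined up to \<open>M\<close>, where \<open>\<chi>\<close> vanishes; so the choice in
    \<open>\<phi>\<close> is harmless.\<close>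
  define R where "R v c \<longleftrightarrow> c \<in> C \<and> (\<exists>u\<in>U. v = u \<oplus>\<^bsub>W\<^esub> \<rho> c w)" for v c
  define \<phi> where "\<phi> v = \<chi> (SOME c. R v c)" for v
  have uniq: "\<chi> c = \<chi> d" if c: "R v c" and d: "R v d" for v c d
  proof -
    obtain u u' where u: "u \<in> U" "u' \<in> U" "c \<in> C" "d \<in> C" "v = u \<oplus>\<^bsub>W\<^esub> \<rho> c w" "v = u' \<oplus>\<^bsub>W\<^esub> \<rho> d w"
      using c d by (auto simp: R_def)
    have [simp]: "u \<in> carrier W" "u' \<in> carrier W" "c \<in> carrier Q" "d \<in> carrier Q" "w \<in> carrier W"
      using u UD(2) w by auto
    let ?e = "c \<oplus> (- 1) \<odot> d"
    have e: "?e \<in> C" using C_D(4)[OF u(3) C_D(6)[OF u(4)]] .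
    have "\<rho> ?e w = \<rho> c w \<oplus>\<^bsub>W\<^esub> (- 1) \<odot>\<^bsub>W\<^esub> \<rho> d w"
      by (simp add: rho_add rho_smult)
    also have "\<dots> = u' \<oplus>\<^bsub>W\<^esub> (- 1) \<odot>\<^bsub>W\<^esub> u"
    proof -
      have neg: "x \<oplus>\<^bsub>W\<^esub> (- 1) \<odot>\<^bsub>W\<^esub> x = \<zero>\<^bsub>W\<^esub>" if "x \<in> carrier W" for x
        using W.smult_l_distr[of 1 "- 1" x] W.smult_one[of x] that by simp
      have eq: "u \<oplus>\<^bsub>W\<^esub> \<rho> c w = u' \<oplus>\<^bsub>W\<^esub> \<rho> d w" using u(5,6) by simp
      have "\<rho> c w \<oplus>\<^bsub>W\<^esub> (- 1) \<odot>\<^bsub>W\<^esub> \<rho> d w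
          = (u \<oplus>\<^bsub>W\<^esub> \<rho> c w) \<oplus>\<^bsub>W\<^esub> ((- 1) \<odot>\<^bsub>W\<^esub> u \<oplus>\<^bsub>W\<^esub> (- 1) \<odot>\<^bsub>W\<^esub> \<rho> d w)"
      proof -
        have "(u \<oplus>\<^bsub>W\<^esub> \<rho> c w) \<oplus>\<^bsub>W\<^esub> ((- 1) \<odot>\<^bsub>W\<^esub> u \<oplus>\<^bsub>W\<^esub> (- 1) \<odot>\<^bsub>W\<^esub> \<rho> d w)
          = (u \<oplus>\<^bsub>W\<^esub> (- 1) \<odot>\<^bsub>W\<^esub> u) \<oplus>\<^bsub>W\<^esub> (\<rho> c w \<oplus>\<^bsub>W\<^esub> (- 1) \<odot>\<^bsub>W\<^esub> \<rho> d w)"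
          by (simp add: W.M.a_ac)
        then show ?thesis by (simp add: neg)
      qed
      also have "\<dots> = (u' \<oplus>\<^bsub>W\<^esub> (- 1) \<odot>\<^bsub>W\<^esub> u) \<oplus>\<^bsub>W\<^esub> (\<rho> d w \<oplus>\<^bsub>W\<^esub> (- 1) \<odot>\<^bsub>W\<^esub> \<rho> d w)"
        unfolding eq by (simp add: W.M.a_ac)
      finally show ?thesis by (simp add: neg)
    qed
    also have "\<dots> \<in> U" using u UD(4,5) by blast
    finally have "?e \<in> M" using e by (simp add: M_def)
    then have "\<chi> ?e = 0" by (rule \<chi>(5))
    then have "\<chi> c + (- 1) * \<chi> d = 0"
      using \<chi>(2)[OF u(3) C_D(6)[OF u(4)]] \<chi>(4)[OF u(4)] by metis
    then show ?thesis by simp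
  qed
  have ex: "\<exists>c. R v c" if "v \<in> carrier W" for v
    using cyc[OF _ _ w that] unfolding R_def by blast
  have \<phi>: "\<phi> v = \<chi> c" if "R v c" for v c
    using uniq[OF someI[of "R v", OF that] that] by (simp add: \<phi>_def)
  have "R w \<one>"
    unfolding R_def using w UD(3) C_D(2) by (auto intro!: bexI[of _ "\<zero>\<^bsub>W\<^esub>"])
  then have "\<phi> w = 1" using \<phi> \<chi>(1) by simp
  moreover have "\<phi> (v \<oplus>\<^bsub>W\<^esub> v') = \<phi> v + \<phi> v'" if v: "v \<in> carrier W" and v': "v' \<in> carrier W" for v v'
  proof -
    obtain c where c: "R v c" using ex[OF v] by (elim exE)
    obtain c' where c': "R v' c'" using ex[OF v'] by (elim exE)
    from c c' obtain u u' where u: "u \<in> U" "u' \<in> U" "c \<in> C" "c' \<in> C" "v = u \<oplus>\<^bsub>W\<^esub> \<rho> c w" "v' = u' \<oplus>\<^bsub>W\<^esub> \<rho> c' w"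
      by (auto simp: R_def)
    have "v \<oplus>\<^bsub>W\<^esub> v' = (u \<oplus>\<^bsub>W\<^esub> u') \<oplus>\<^bsub>W\<^esub> \<rho> (c \<oplus> c') w"
      using u UD(2) w by (simp add: rho_add W.M.a_ac)
    then have "R (v \<oplus>\<^bsub>W\<^esub> v') (c \<oplus> c')" unfolding R_def using u UD(4) C_D(4) by blast
    from \<phi>[OF this] \<phi>[OF c] \<phi>[OF c'] show ?thesis using \<chi>(2)[OF u(3,4)] by simp
  qed
  moreover have "\<phi> (d \<odot>\<^bsub>W\<^esub> v) = d * \<phi> v" if "v \<in> carrier W" for d v
  proof -
    obtain c where c: "R v c" using ex[OF \<open>v \<in> carrier W\<close>] by (elim exE)
    then obtain u where u: "u \<in> U" "c \<in> C" "v = u \<oplus>\<^bsub>W\<^esub> \<rho> c w" by (auto simp: R_def)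
    have "d \<odot>\<^bsub>W\<^esub> v = d \<odot>\<^bsub>W\<^esub> u \<oplus>\<^bsub>W\<^esub> \<rho> (d \<odot> c) w"
      using u UD(2) w by (simp add: W_smult_r_distr rho_smult)
    then have "R (d \<odot>\<^bsub>W\<^esub> v) (d \<odot> c)" unfolding R_def using u UD(5) C_D(6) by blast
    from \<phi>[OF this] \<phi>[OF c] show ?thesis using \<chi>(4)[OF u(2)] by simp
  qed
  moreover have "\<phi> (\<rho> d v) = \<chi> d * \<phi> v" if "d \<in> C" "v \<in> carrier W" for d v
  proof -
    obtain c where c: "R v c" using ex[OF \<open>v \<in> carrier W\<close>] by (elim exE)
    then obtain u where u: "u \<in> U" "c \<in> C" "v = u \<oplus>\<^bsub>W\<^esub> \<rho> c w" by (auto simp: R_def)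
    have "\<rho> d v = \<rho> d u \<oplus>\<^bsub>W\<^esub> \<rho> (d \<otimes> c) w"
      using u UD(2) w \<open>d \<in> C\<close> by (simp add: rho_vadd rho_mult)
    then have "R (\<rho> d v) (d \<otimes> c)" unfolding R_def using u UD(6)[OF \<open>d \<in> C\<close>] C_D(5)[OF \<open>d \<in> C\<close>] by blast
    from \<phi>[OF this] \<phi>[OF c] show ?thesis using \<chi>(3)[OF \<open>d \<in> C\<close> u(2)] by simp
  qed
  ultimately show ?thesis using w(1) by (intro exI[of _ \<phi>] exI[of _ \<chi>] exI[of _ w]) simp
qed

text \<open>The functionals counted are \<open>v \<mapsto> \<phi> (\<rho> e v)\<close> for
  \<open>e\<close> in \<open>E\<close>; their common kernel is the submodule \<open>N\<close> of the
  proof, which irreducibility forces to be zero.\<close>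

theorem edim_le_card_span:
  assumes E: "finite E" "E \<subseteq> SA"
    and span: "\<And>U. VectorSpace.subspace class_ring U Q \<Longrightarrow> E \<subseteq> U \<Longrightarrow> SA \<subseteq> U"
  shows "edim W \<le> enat (card E)"
proof -
  obtain \<phi> \<chi> w where ef: "w \<in> carrier W \<and> \<phi> w = (1 :: 'k) \<and>
     (\<forall>v\<in>carrier W. \<forall>w\<in>carrier W. \<phi> (v \<oplus>\<^bsub>W\<^esub> w) = \<phi> v + \<phi> w) \<and>
     (\<forall>c. \<forall>w\<in>carrier W. \<phi> (c \<odot>\<^bsub>W\<^esub> w) = c * \<phi> w) \<and>
     (\<forall>c\<in>C. \<forall>w\<in>carrier W. \<phi> (\<rho> c w) = \<chi> c * \<phi> w)"
    using eigenfunctional by (elim exE)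
  have w: "w \<in> carrier W" "\<phi> w = 1" using ef by simp_all
  have \<phi>_add: "\<phi> (v \<oplus>\<^bsub>W\<^esub> w) = \<phi> v + \<phi> w" if "v \<in> carrier W" "w \<in> carrier W" for v w
    using ef that by simp
  have \<phi>_smult: "\<phi> (c \<odot>\<^bsub>W\<^esub> w) = c * \<phi> w" if "w \<in> carrier W" for c w
    using ef that by simp
  have \<phi>_C: "\<phi> (\<rho> c w) = \<chi> c * \<phi> w" if "c \<in> C" "w \<in> carrier W" for c w
    using ef that by simp
  have \<phi>_zero: "\<phi> \<zero>\<^bsub>W\<^esub> = 0" using \<phi>_smult[of "\<zero>\<^bsub>W\<^esub>" 0] by simp
  have ann: "VectorSpace.subspace class_ring {x \<in> carrier Q. \<phi> (\<rho> x v) = 0} Q" if "v \<in> carrier W" for v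
    unfolding subspace_alg_iff
    using that by (auto simp: rho_add rho_smult \<phi>_add \<phi>_smult \<phi>_zero)
  have sum_split: "\<phi> (\<rho> (fst p) v) + \<phi> (\<rho> (snd p) v) = \<chi> (fst p \<oplus> snd p) * \<phi> v"
    if p: "p \<in> X" and v: "v \<in> carrier W" for p v
    using \<phi>_C[OF pair_sum_C[OF p] v] pair_carrier[OF p] v by (simp add: rho_add \<phi>_add)
  define N where "N = {v \<in> carrier W. \<forall>a\<in>SA. \<phi> (\<rho> a v) = 0}"
  have NA: "\<phi> (\<rho> a v) = 0" if "v \<in> N" "a \<in> SA" for a v
    using that by (simp add: N_def)
  have N_carrier: "v \<in> carrier W" if "v \<in> N" for v using that by (simp add: N_def)
  \<comment> \<open>Because the unit lies in \<open>SA\<close>, the right-hand side of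
    \<open>sum_split\<close> vanishes on \<open>N\<close>. This lets the vanishing condition pass
    from first to second components; \<open>NI\<close> is the way back, through the unit of
    \<open>SB\<close>.\<close>
  have N_one: "\<phi> v = 0" if "v \<in> N" for v using NA[OF that SA_D(2)] N_carrier[OF that] by simp
  have NB: "\<phi> (\<rho> b v) = 0" if v: "v \<in> N" and b: "b \<in> SB" for b v
  proof -
    have "SB \<subseteq> {x \<in> carrier Q. \<phi> (\<rho> x v) = 0}"
    proof (rule spanB[OF ann[OF N_carrier[OF v]]])
      have "snd p \<in> {x \<in> carrier Q. \<phi> (\<rho> x v) = 0}" if p: "p \<in> X" for p
        using sum_split[OF p N_carrier[OF v]] NA[OF v, of "fst p"] N_one[OF v] pair_carrier[OF p] by simp
      moreover have "\<one> \<in> {x \<in> carrier Q. \<phi> (\<rho> x v) = 0}" using N_one[OF v] N_carrier[OF v] by simp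
      ultimately show "insert \<one> (snd ` X) \<subseteq> {x \<in> carrier Q. \<phi> (\<rho> x v) = 0}" by blast
    qed
    with b show ?thesis by blast
  qed
  have NI: "v \<in> N" if v: "v \<in> carrier W" and B: "\<And>b. b \<in> SB \<Longrightarrow> \<phi> (\<rho> b v) = 0" for v
  proof -
    have one: "\<phi> v = 0" using B[OF SB_D(2)] v by simp
    have "SA \<subseteq> {x \<in> carrier Q. \<phi> (\<rho> x v) = 0}"
    proof (rule spanA[OF ann[OF v]])
      have "fst p \<in> {x \<in> carrier Q. \<phi> (\<rho> x v) = 0}" if p: "p \<in> X" for p
        using sum_split[OF p v] B[of "snd p"] one pair_carrier[OF p] by simp
      moreover have "\<one> \<in> {x \<in> carrier Q. \<phi> (\<rho> x v) = 0}" using one v by simp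
      ultimately show "insert \<one> (fst ` X) \<subseteq> {x \<in> carrier Q. \<phi> (\<rho> x v) = 0}" by blast
    qed
    then show ?thesis using v by (auto simp: N_def)
  qed
  have N: "VectorSpace.subspace class_ring N W"
    unfolding subspace_W_iff N_def
    by (auto simp: rho_vadd rho_vsmult \<phi>_add \<phi>_smult \<phi>_zero)
  have "carrier Q \<subseteq> {x \<in> carrier Q. \<forall>v\<in>N. \<rho> x v \<in> N}"
  proof (rule gen[OF stabilizer_subalgebra[OF N]])
    have "\<rho> a v \<in> N" if a: "a \<in> SA" and v: "v \<in> N" for a v
    proof -
      have "\<phi> (\<rho> a' (\<rho> a v)) = 0" if a': "a' \<in> SA" for a'
        using NA[OF v SA_D(5)[OF a' a]] a a' N_carrier[OF v] by (simp add: rho_mult)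
      then show ?thesis using a N_carrier[OF v] by (simp add: N_def)
    qed
    moreover have "\<rho> b v \<in> N" if b: "b \<in> SB" and v: "v \<in> N" for b v
    proof (rule NI)
      show "\<rho> b v \<in> carrier W" using b N_carrier[OF v] by simp
      show "\<phi> (\<rho> b' (\<rho> b v)) = 0" if b': "b' \<in> SB" for b'
        using NB[OF v SB_D(5)[OF b' b]] b b' N_carrier[OF v] by (simp add: rho_mult)
    qed
    ultimately show "SA \<union> SB \<subseteq> {x \<in> carrier Q. \<forall>v\<in>N. \<rho> x v \<in> N}" by auto
  qed
  then have "N = {\<zero>\<^bsub>W\<^esub>} \<or> N = carrier W" by (intro irrD[OF N]) auto
  moreover have "N \<noteq> carrier W" using N_one w by force
  ultimately have N0: "N = {\<zero>\<^bsub>W\<^esub>}" by simp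
  show ?thesis
  proof (rule edim_le_card_functionals[OF vs_W E(1), of "\<lambda>e v. \<phi> (\<rho> e v)"])
    have EQ: "e \<in> carrier Q" if "e \<in> E" for e using that E(2) by auto
    show "\<phi> (\<rho> e (v \<oplus>\<^bsub>W\<^esub> w)) = \<phi> (\<rho> e v) + \<phi> (\<rho> e w)" if "e \<in> E" "v \<in> carrier W" "w \<in> carrier W" for e v w
      using that EQ by (simp add: rho_vadd \<phi>_add)
    show "\<phi> (\<rho> e (c \<odot>\<^bsub>W\<^esub> w)) = c * \<phi> (\<rho> e w)" if "e \<in> E" "w \<in> carrier W" for e c w
      using that EQ by (simp add: rho_vsmult \<phi>_smult)
    show "v = \<zero>\<^bsub>W\<^esub>" if v: "v \<in> carrier W" and e: "\<And>e. e \<in> E \<Longrightarrow> \<phi> (\<rho> e v) = 0" for v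
    proof -
      have "SA \<subseteq> {x \<in> carrier Q. \<phi> (\<rho> x v) = 0}"
        by (rule span[OF ann[OF v]]) (use e EQ in auto)
      then have "v \<in> N" using v by (auto simp: N_def)
      with N0 show ?thesis by simp
    qed
  qed
qed

end

section \<open>Free algebras, quotients and algebra homomorphisms\<close>

lemma unital_algebraI:
  fixes A :: "('k :: field, 'a) module"
  assumes "ring A"
    and "\<And>c x. x \<in> carrier A \<Longrightarrow> c \<odot>\<^bsub>A\<^esub> x \<in> carrier A"
    and "\<And>c d x. x \<in> carrier A \<Longrightarrow> (c + d) \<odot>\<^bsub>A\<^esub> x = c \<odot>\<^bsub>A\<^esub> x \<oplus>\<^bsub>A\<^esub> d \<odot>\<^bsub>A\<^esub> x"
    and "\<And>c x y. x \<in> carrier A \<Longrightarrow> y \<in> carrier A \<Longrightarrow> c \<odot>\<^bsub>A\<^esub> (x \<oplus>\<^bsub>A\<^esub> y) = c \<odot>\<^bsub>A\<^esub> x \<oplus>\<^bsub>A\<^esub> c \<odot>\<^bsub>A\<^esub> y"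
    and "\<And>c d x. x \<in> carrier A \<Longrightarrow> (c * d) \<odot>\<^bsub>A\<^esub> x = c \<odot>\<^bsub>A\<^esub> (d \<odot>\<^bsub>A\<^esub> x)"
    and "\<And>x. x \<in> carrier A \<Longrightarrow> 1 \<odot>\<^bsub>A\<^esub> x = x"
    and "\<And>c x y. x \<in> carrier A \<Longrightarrow> y \<in> carrier A \<Longrightarrow> c \<odot>\<^bsub>A\<^esub> (x \<otimes>\<^bsub>A\<^esub> y) = (c \<odot>\<^bsub>A\<^esub> x) \<otimes>\<^bsub>A\<^esub> y"
    and "\<And>c x y. x \<in> carrier A \<Longrightarrow> y \<in> carrier A \<Longrightarrow> c \<odot>\<^bsub>A\<^esub> (x \<otimes>\<^bsub>A\<^esub> y) = x \<otimes>\<^bsub>A\<^esub> (c \<odot>\<^bsub>A\<^esub> y)"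
  shows "unital_algebra A"
proof -
  interpret ring A by fact
  have "module class_ring A"
    by (rule Module.moduleI[OF class_cring.is_cring is_abelian_group]) (use assms in auto)
  then have "vectorspace class_ring A"
    using class_field by (simp add: vectorspace_def)
  then show ?thesis
    using assms by (intro unital_algebra.intro unital_algebra_axioms.intro) auto
qed

lemma free_algebra_simps [simp]:
  "carrier (free_algebra X) = {f. finite {w. f w \<noteq> 0} \<and> {w. f w \<noteq> 0} \<subseteq> lists X}"
  "f \<otimes>\<^bsub>free_algebra X\<^esub> g = (\<lambda>w. \<Sum>i\<le>length w. f (take i w) * g (drop i w))"
  "f \<oplus>\<^bsub>free_algebra X\<^esub> g = (\<lambda>w. f w + g w)"
  "\<zero>\<^bsub>free_algebra X\<^esub> = (\<lambda>w. 0)"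
  "\<one>\<^bsub>free_algebra X\<^esub> = (\<lambda>w. if w = [] then 1 else 0)"
  "c \<odot>\<^bsub>free_algebra X\<^esub> f = (\<lambda>w. c * f w)"
  by (simp_all add: free_algebra_def)

text \<open>Both sides sum over the ways to cut \<open>w\<close> into three pieces. The left side
  records the two cut positions \<open>j \<le> i\<close>, the right side the first cut and the
  length \<open>k = i - j\<close> of the middle piece.\<close>

lemma convolution_assoc:
  fixes f g h :: "'x list \<Rightarrow> 'k :: comm_semiring_0"
  shows "(\<Sum>i\<le>length w. (\<Sum>j\<le>length (take i w). f (take j (take i w)) * g (drop j (take i w))) * h (drop i w)) =
    (\<Sum>j\<le>length w. f (take j w) * (\<Sum>k\<le>length (drop j w). g (take k (drop j w)) * h (drop k (drop j w))))"
    (is "?L = ?R")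
proof -
  have "?L = (\<Sum>i\<le>length w. \<Sum>j\<le>i. f (take j w) * g (drop j (take i w)) * h (drop i w))"
    by (rule sum.cong) (auto simp: sum_distrib_right min_absorb1 min_absorb2 intro!: sum.cong)
  also have "\<dots> = (\<Sum>(i, j)\<in>Sigma {..length w} (\<lambda>i. {..i}). f (take j w) * g (drop j (take i w)) * h (drop i w))"
    by (simp add: sum.Sigma)
  also have "\<dots> = (\<Sum>(j, k)\<in>Sigma {..length w} (\<lambda>j. {..length w - j}).
      f (take j w) * (g (take k (drop j w)) * h (drop k (drop j w))))"
    by (rule sum.reindex_bij_witness[of _ "\<lambda>(j, k). (j + k, j)" "\<lambda>(i, j). (j, i - j)"])
      (auto simp: drop_take mult.assoc)
  also have "\<dots> = ?R"
    by (simp add: sum.Sigma[symmetric] sum_distrib_left)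
  finally show ?thesis .
qed

lemma free_algebra_unital_algebra: "unital_algebra (free_algebra X :: ('k :: field, 'x list \<Rightarrow> 'k) module)"
proof (rule unital_algebraI)
  let ?F = "free_algebra X :: ('k :: field, 'x list \<Rightarrow> 'k) module"
  have add: "f \<oplus>\<^bsub>?F\<^esub> g \<in> carrier ?F" if "f \<in> carrier ?F" "g \<in> carrier ?F" for f g
  proof -
    have "{w. f w + g w \<noteq> 0} \<subseteq> {w. f w \<noteq> 0} \<union> {w. g w \<noteq> 0}" by auto
    then show ?thesis using that finite_subset[of "{w. f w + g w \<noteq> 0}" "{w. f w \<noteq> 0} \<union> {w. g w \<noteq> 0}"] by auto
  qed
  have smult: "c \<odot>\<^bsub>?F\<^esub> f \<in> carrier ?F" if "f \<in> carrier ?F" for c f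
  proof -
    have "{w. c * f w \<noteq> 0} \<subseteq> {w. f w \<noteq> 0}" by auto
    then show ?thesis using that finite_subset[of "{w. c * f w \<noteq> 0}" "{w. f w \<noteq> 0}"] by auto
  qed
  have mult: "f \<otimes>\<^bsub>?F\<^esub> g \<in> carrier ?F" if f: "f \<in> carrier ?F" and g: "g \<in> carrier ?F" for f g
  proof -
    \<comment> \<open>A product is supported on concatenations of words from the two supports, a
      finite set of words over \<open>X\<close>.\<close>
    let ?S = "(\<lambda>(u, v). u @ v) ` ({w. f w \<noteq> 0} \<times> {w. g w \<noteq> 0})"
    have sub: "{w. (f \<otimes>\<^bsub>?F\<^esub> g) w \<noteq> 0} \<subseteq> ?S"
    proof
      fix w assume "w \<in> {w. (f \<otimes>\<^bsub>?F\<^esub> g) w \<noteq> 0}"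
      then have "(\<Sum>i\<le>length w. f (take i w) * g (drop i w)) \<noteq> 0" by simp
      then obtain i where "f (take i w) * g (drop i w) \<noteq> 0" using sum.not_neutral_contains_not_neutral by blast
      then show "w \<in> ?S" by (intro image_eqI[of _ _ "(take i w, drop i w)"]) auto
    qed
    have fin: "finite ?S" using f g by simp
    have uv: "u @ v \<in> lists X" if "f u \<noteq> 0" "g v \<noteq> 0" for u v
    proof -
      have "u \<in> lists X" "v \<in> lists X" using that f g by (simp_all add: subset_iff)
      then show ?thesis by simp
    qed
    have lists: "?S \<subseteq> lists X"
    proof (rule image_subsetI)
      fix p assume "p \<in> {w. f w \<noteq> 0} \<times> {w. g w \<noteq> 0}"
      then show "(case p of (u, v) \<Rightarrow> u @ v) \<in> lists X"
        using uv[of "fst p" "snd p"] by (simp only: case_prod_beta mem_Times_iff mem_Collect_eq simp_thms)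
    qed
    from finite_subset[OF sub fin] subset_trans[OF sub lists] show ?thesis by simp
  qed
  show "ring ?F"
  proof (rule ringI)
    show "abelian_group ?F"
    proof (rule abelian_groupI)
      show "\<exists>g\<in>carrier ?F. g \<oplus>\<^bsub>?F\<^esub> f = \<zero>\<^bsub>?F\<^esub>" if "f \<in> carrier ?F" for f
        using smult[OF that, of "- 1"] by (intro bexI[of _ "(- 1) \<odot>\<^bsub>?F\<^esub> f"]) auto
    qed (use add in \<open>auto simp: algebra_simps\<close>)
    show "Group.monoid ?F"
    proof (rule monoidI)
      show "\<one>\<^bsub>?F\<^esub> \<in> carrier ?F" by auto
      show "f \<otimes>\<^bsub>?F\<^esub> g \<otimes>\<^bsub>?F\<^esub> h = f \<otimes>\<^bsub>?F\<^esub> (g \<otimes>\<^bsub>?F\<^esub> h)" for f g h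
        by (rule ext) (simp only: free_algebra_simps convolution_assoc)
      show "\<one>\<^bsub>?F\<^esub> \<otimes>\<^bsub>?F\<^esub> f = f" for f
      proof
        fix w
        have "(\<one>\<^bsub>?F\<^esub> \<otimes>\<^bsub>?F\<^esub> f) w = (\<Sum>i\<le>length w. if i = 0 then f w else 0)"
          unfolding free_algebra_simps by (rule sum.cong) auto
        then show "(\<one>\<^bsub>?F\<^esub> \<otimes>\<^bsub>?F\<^esub> f) w = f w" by simp
      qed
      show "f \<otimes>\<^bsub>?F\<^esub> \<one>\<^bsub>?F\<^esub> = f" for f
      proof
        fix w
        have "(f \<otimes>\<^bsub>?F\<^esub> \<one>\<^bsub>?F\<^esub>) w = (\<Sum>i\<le>length w. if i = length w then f w else 0)"
          unfolding free_algebra_simps by (rule sum.cong) auto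
        then show "(f \<otimes>\<^bsub>?F\<^esub> \<one>\<^bsub>?F\<^esub>) w = f w" by simp
      qed
    qed (rule mult)
  qed (auto simp: algebra_simps sum.distrib)
qed (auto simp: algebra_simps sum_distrib_left intro: finite_subset)

lemma free_gen_closed: "x \<in> X \<Longrightarrow> free_gen x \<in> carrier (free_algebra X)"
  by (auto simp: free_gen_def)

text \<open>Indicator functions of words are products of letters, and every element is a finite
  combination of them. The set \<open>S\<close> in \<open>main\<close> only bounds the support, so
  that clearing one word of \<open>f\<close> fits the induction hypothesis.\<close>

lemma free_algebra_generated:
  assumes T: "subalgebra_of T (free_algebra X)" and gen: "free_gen ` X \<subseteq> T"
  shows "carrier (free_algebra X) \<subseteq> (T :: ('x list \<Rightarrow> 'k :: field) set)"
proof -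
  interpret F: unital_algebra "free_algebra X :: ('k, 'x list \<Rightarrow> 'k) module"
    by (rule free_algebra_unital_algebra)
  define word :: "'x list \<Rightarrow> 'x list \<Rightarrow> 'k" where "word u = (\<lambda>w. if w = u then 1 else 0)" for u
  have word: "word u \<in> T" if "u \<in> lists X" for u
    using that
  proof (induction u)
    case Nil
    then show ?case using F.subalgebraD(2)[OF T] by (simp add: word_def)
  next
    case (Cons x u)
    \<comment> \<open>In the convolution only the cut after the first letter contributes, since
      \<open>free_gen x\<close> is supported on a one-letter word.\<close>
    have eq: "word (x # u) = free_gen x \<otimes>\<^bsub>free_algebra X\<^esub> word u"
    proof
      fix w
      show "word (x # u) w = (free_gen x \<otimes>\<^bsub>free_algebra X\<^esub> word u) w"
      proof (cases w)
        case (Cons y v)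
        have "(free_gen x \<otimes>\<^bsub>free_algebra X\<^esub> word u) w
          = (\<Sum>i\<le>length w. if i = 1 then free_gen x [y] * word u v else 0)"
          unfolding free_algebra_simps
        proof (rule sum.cong)
          fix i assume "i \<in> {..length w}"
          then show "free_gen x (take i w) * word u (drop i w) = (if i = 1 then free_gen x [y] * word u v else 0)"
            by (cases i) (auto simp: Cons free_gen_def)
        qed simp
        also have "\<dots> = word (x # u) w" by (auto simp: Cons free_gen_def word_def Suc_le_eq)
        finally show ?thesis by simp
      qed (simp add: word_def free_gen_def)
    qed
    show ?case
      unfolding eq by (rule F.subalgebraD(5)[OF T]) (use Cons gen in auto)
  qed
  have main: "f \<in> T" if "finite S" "S \<subseteq> lists X" "{w. f w \<noteq> 0} \<subseteq> S" for S and f :: "'x list \<Rightarrow> 'k"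
    using that
  proof (induction S arbitrary: f rule: finite_induct)
    case empty
    then have "f = \<zero>\<^bsub>free_algebra X\<^esub>" by auto
    then show ?case using F.subalgebraD(3)[OF T] by simp
  next
    case (insert u S)
    have 1: "f(u := 0) \<in> T" by (rule insert.IH) (use insert.prems in auto)
    have 2: "f u \<odot>\<^bsub>free_algebra X\<^esub> word u \<in> T"
      by (rule F.subalgebraD(6)[OF T word]) (use insert.prems in auto)
    have "f = f(u := 0) \<oplus>\<^bsub>free_algebra X\<^esub> f u \<odot>\<^bsub>free_algebra X\<^esub> word u"
      by (auto simp: word_def)
    also have "\<dots> \<in> T" by (rule F.subalgebraD(4)[OF T 1 2])
    finally show ?case .
  qed
  show ?thesis
  proof
    fix f :: "'x list \<Rightarrow> 'k" assume "f \<in> carrier (free_algebra X)"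
    then show "f \<in> T" using main[of "{w. f w \<noteq> 0}" f] by simp
  qed
qed

section \<open>Algebra homomorphisms and quotient algebras\<close>

definition algebra_hom :: "('k :: field, 'a) module \<Rightarrow> ('k, 'b) module \<Rightarrow> ('a \<Rightarrow> 'b) \<Rightarrow> bool" where
  "algebra_hom A B f \<longleftrightarrow> f \<in> Ring.ring_hom A B \<and> (\<forall>c. \<forall>x\<in>carrier A. f (c \<odot>\<^bsub>A\<^esub> x) = c \<odot>\<^bsub>B\<^esub> f x)"

lemma algebra_homD:
  assumes "algebra_hom A B f"
  shows "x \<in> carrier A \<Longrightarrow> f x \<in> carrier B" "f \<one>\<^bsub>A\<^esub> = \<one>\<^bsub>B\<^esub>"
    "x \<in> carrier A \<Longrightarrow> y \<in> carrier A \<Longrightarrow> f (x \<oplus>\<^bsub>A\<^esub> y) = f x \<oplus>\<^bsub>B\<^esub> f y"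
    "x \<in> carrier A \<Longrightarrow> y \<in> carrier A \<Longrightarrow> f (x \<otimes>\<^bsub>A\<^esub> y) = f x \<otimes>\<^bsub>B\<^esub> f y"
    "x \<in> carrier A \<Longrightarrow> f (c \<odot>\<^bsub>A\<^esub> x) = c \<odot>\<^bsub>B\<^esub> f x"
  using assms unfolding algebra_hom_def
  by (auto simp: ring_hom_closed ring_hom_one ring_hom_add ring_hom_mult)

lemma algebra_hom_zero:
  assumes "algebra_hom A B f" "unital_algebra A" "unital_algebra B"
  shows "f \<zero>\<^bsub>A\<^esub> = \<zero>\<^bsub>B\<^esub>"
  using assms ring_hom_zero unfolding algebra_hom_def unital_algebra_def by blast

lemma algebra_hom_comp:
  "algebra_hom A B f \<Longrightarrow> algebra_hom B D g \<Longrightarrow> algebra_hom A D (\<lambda>x. g (f x))"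
  using ring_hom_trans[of f A B g D] unfolding algebra_hom_def comp_def
  by (auto simp: ring_hom_closed)

lemma subalgebra_image:
  assumes "algebra_hom A B f" "unital_algebra A" "unital_algebra B"
  shows "subalgebra_of (f ` carrier A) B"
proof -
  interpret A: unital_algebra A by fact
  interpret B: unital_algebra B by fact
  note hom = algebra_homD[OF assms(1)]
  show ?thesis
    unfolding B.subalgebra_of_iff
  proof (intro conjI ballI allI)
    show "\<one>\<^bsub>B\<^esub> \<in> f ` carrier A" using hom(2) A.one_closed by (metis imageI)
    fix v w assume "v \<in> f ` carrier A" "w \<in> f ` carrier A"
    then obtain x y where xy: "x \<in> carrier A" "y \<in> carrier A" "v = f x" "w = f y" by auto
    show "v \<oplus>\<^bsub>B\<^esub> w \<in> f ` carrier A" using xy hom(3)[of x y] by (metis A.a_closed imageI)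
    show "v \<otimes>\<^bsub>B\<^esub> w \<in> f ` carrier A" using xy hom(4)[of x y] by (metis A.m_closed imageI)
  next
    fix c w assume "w \<in> f ` carrier A"
    then obtain y where y: "y \<in> carrier A" "w = f y" by auto
    show "c \<odot>\<^bsub>B\<^esub> w \<in> f ` carrier A" using y hom(5)[of y c] by (metis A.smult_closed' imageI)
  qed (use hom(1) in auto)
qed

lemma subspace_vimage:
  assumes "algebra_hom A B f" "unital_algebra A" "unital_algebra B" and U: "VectorSpace.subspace class_ring U B"
  shows "VectorSpace.subspace class_ring {x \<in> carrier A. f x \<in> U} A"
proof -
  interpret A: unital_algebra A by fact
  interpret B: unital_algebra B by fact
  show ?thesis
    using U algebra_homD[OF assms(1)] algebra_hom_zero[OF assms(1-3)]
    unfolding A.subspace_alg_iff B.subspace_alg_iff by auto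
qed

lemma subalgebra_vimage:
  assumes "algebra_hom A B f" "unital_algebra A" "unital_algebra B" and T: "subalgebra_of T B"
  shows "subalgebra_of {x \<in> carrier A. f x \<in> T} A"
proof -
  interpret A: unital_algebra A by fact
  interpret B: unital_algebra B by fact
  show ?thesis
    using T algebra_homD[OF assms(1)]
    unfolding A.subalgebra_of_iff B.subalgebra_of_iff by auto
qed

lemma quotient_algebra_simps:
  "carrier (quotient_algebra A I) = carrier (A Quot I)"
  "mult (quotient_algebra A I) = mult (A Quot I)"
  "add (quotient_algebra A I) = add (A Quot I)"
  "one (quotient_algebra A I) = one (A Quot I)"
  "zero (quotient_algebra A I) = zero (A Quot I)"
  "c \<odot>\<^bsub>quotient_algebra A I\<^esub> X = (\<Union>x\<in>X. I +>\<^bsub>A\<^esub> (c \<odot>\<^bsub>A\<^esub> x))"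
  by (simp_all add: quotient_algebra_def ring.extend_def module.fields_def)

lemma ring_quotient_algebra:
  assumes "ring (A Quot I)"
  shows "ring (quotient_algebra A I)"
proof -
  interpret R: ring "A Quot I" by fact
  note s = quotient_algebra_simps(1-5)
  show ?thesis
  proof (rule ringI)
    show "abelian_group (quotient_algebra A I)"
    proof (rule abelian_groupI)
      show "\<exists>y\<in>carrier (quotient_algebra A I). y \<oplus>\<^bsub>quotient_algebra A I\<^esub> x = \<zero>\<^bsub>quotient_algebra A I\<^esub>"
        if "x \<in> carrier (quotient_algebra A I)" for x
        unfolding s using R.a_inv_closed R.l_neg that[unfolded s] by blast
    qed (unfold s, auto simp: R.a_ac)
    show "Group.monoid (quotient_algebra A I)"
      by (rule monoidI) (unfold s, auto simp: R.m_assoc)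
  qed (unfold s, auto simp: R.l_distr R.r_distr)
qed

text \<open>The point is that scalars act on cosets. Since \<open>c x = (c 1) x\<close>, scalar
  multiplication is multiplication by an element of the algebra, which the ring homomorphism to the
  quotient respects.\<close>

lemma quotient_algebra_hom:
  fixes A :: "('k :: field, 'a) module"
  assumes A: "unital_algebra A" and I: "ideal I A"
  shows "unital_algebra (quotient_algebra A I)" "algebra_hom A (quotient_algebra A I) (\<lambda>x. I +>\<^bsub>A\<^esub> x)"
    "(\<lambda>x. I +>\<^bsub>A\<^esub> x) ` carrier A = carrier (quotient_algebra A I)"
proof -
  interpret A: unital_algebra A by fact
  interpret I: ideal I A by fact
  let ?Q = "quotient_algebra A I"
  let ?\<pi> = "\<lambda>x. I +>\<^bsub>A\<^esub> x"
  have ringQ: "ring ?Q" by (rule ring_quotient_algebra[OF I.quotient_is_ring])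
  interpret Q: ring ?Q by (rule ringQ)
  have \<pi>: "?\<pi> \<in> Ring.ring_hom A ?Q"
    using I.rcos_ring_hom unfolding Ring.ring_hom_def quotient_algebra_simps .
  show surj: "?\<pi> ` carrier A = carrier ?Q"
    by (auto simp: quotient_algebra_simps FactRing_def A_RCOSETS_def')
  have smult_\<pi>: "c \<odot>\<^bsub>?Q\<^esub> ?\<pi> x = ?\<pi> (c \<odot>\<^bsub>A\<^esub> x)" if x: "x \<in> carrier A" for c x
  proof -
    \<comment> \<open>All members of the union that defines the scalar multiple of a coset are the
      same coset, so the union collapses to it.\<close>
    have const: "?\<pi> (c \<odot>\<^bsub>A\<^esub> y) = ?\<pi> (c \<odot>\<^bsub>A\<^esub> x)" if y: "y \<in> ?\<pi> x" for y
    proof -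
      have yc: "y \<in> carrier A" by (rule I.a_elemrcos_carrier[OF x y])
      have eq: "?\<pi> y = ?\<pi> x" using I.a_repr_independence'[OF y x] by simp
      have one: "c \<odot>\<^bsub>A\<^esub> \<one>\<^bsub>A\<^esub> \<in> carrier A" by simp
      show ?thesis
        unfolding A.smult_eq_mult_one[OF yc, of c] A.smult_eq_mult_one[OF x, of c]
          ring_hom_mult[OF \<pi> one yc] ring_hom_mult[OF \<pi> one x] eq ..
    qed
    show ?thesis
      unfolding quotient_algebra_simps by (intro UN_constant_eq[OF I.a_rcos_self[OF x]] ballI const)
  qed
  show unital: "unital_algebra ?Q"
  proof (rule unital_algebraI[OF ringQ])
    fix c d :: 'k and X Y assume "X \<in> carrier ?Q"
    then obtain x where x: "x \<in> carrier A" "X = ?\<pi> x" using surj by auto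
    show "c \<odot>\<^bsub>?Q\<^esub> X \<in> carrier ?Q" using x by (simp add: smult_\<pi> surj[symmetric])
    have add: "?\<pi> u \<oplus>\<^bsub>?Q\<^esub> ?\<pi> v = ?\<pi> (u \<oplus>\<^bsub>A\<^esub> v)" and mult: "?\<pi> u \<otimes>\<^bsub>?Q\<^esub> ?\<pi> v = ?\<pi> (u \<otimes>\<^bsub>A\<^esub> v)"
      if "u \<in> carrier A" "v \<in> carrier A" for u v
      using ring_hom_add[OF \<pi> that] ring_hom_mult[OF \<pi> that] by simp_all
    show "(c + d) \<odot>\<^bsub>?Q\<^esub> X = c \<odot>\<^bsub>?Q\<^esub> X \<oplus>\<^bsub>?Q\<^esub> d \<odot>\<^bsub>?Q\<^esub> X"
      using x by (simp add: smult_\<pi> add A.smult_l_distr')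
    show "(c * d) \<odot>\<^bsub>?Q\<^esub> X = c \<odot>\<^bsub>?Q\<^esub> (d \<odot>\<^bsub>?Q\<^esub> X)"
      using x A.vs.smult_assoc1[of c d x] by (simp add: smult_\<pi>)
    show "1 \<odot>\<^bsub>?Q\<^esub> X = X"
      using x A.vs.smult_one[of x] by (simp add: smult_\<pi>)
    assume "Y \<in> carrier ?Q"
    then obtain y where y: "y \<in> carrier A" "Y = ?\<pi> y" using surj by auto
    show "c \<odot>\<^bsub>?Q\<^esub> (X \<oplus>\<^bsub>?Q\<^esub> Y) = c \<odot>\<^bsub>?Q\<^esub> X \<oplus>\<^bsub>?Q\<^esub> c \<odot>\<^bsub>?Q\<^esub> Y"
      using x y by (simp add: smult_\<pi> add A.smult_r_distr')
    show "c \<odot>\<^bsub>?Q\<^esub> (X \<otimes>\<^bsub>?Q\<^esub> Y) = (c \<odot>\<^bsub>?Q\<^esub> X) \<otimes>\<^bsub>?Q\<^esub> Y"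
      using x y by (simp add: smult_\<pi> mult A.smult_mult_left)
    show "c \<odot>\<^bsub>?Q\<^esub> (X \<otimes>\<^bsub>?Q\<^esub> Y) = X \<otimes>\<^bsub>?Q\<^esub> (c \<odot>\<^bsub>?Q\<^esub> Y)"
      using x y by (simp add: smult_\<pi> mult A.smult_mult_right)
  qed
  show "algebra_hom A ?Q ?\<pi>"
    using \<pi> smult_\<pi> by (simp add: algebra_hom_def)
qed

lemma quotient_algebra_eq:
  assumes A: "unital_algebra A" and I: "ideal I A" and xy: "x \<in> carrier A" "y \<in> carrier A" "x \<ominus>\<^bsub>A\<^esub> y \<in> I"
  shows "I +>\<^bsub>A\<^esub> x = I +>\<^bsub>A\<^esub> y"
proof -
  interpret A: unital_algebra A by fact
  interpret I: ideal I A by fact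
  have "x = (x \<ominus>\<^bsub>A\<^esub> y) \<oplus>\<^bsub>A\<^esub> y" using xy by (simp add: A.minus_eq A.a_assoc A.l_neg)
  then have "x \<in> I +>\<^bsub>A\<^esub> y" using xy(3) by (auto simp: a_r_coset_def')
  from I.a_repr_independence'[OF this xy(2)] show ?thesis by simp
qed

lemma hom_relations_carrier:
  assumes A: "unital_algebra A" and F: "unital_algebra F" and g: "\<And>a. a \<in> carrier A \<Longrightarrow> g a \<in> carrier F"
  shows "hom_relations A F g \<subseteq> carrier F"
proof -
  interpret A: unital_algebra A by fact
  interpret F: unital_algebra F by fact
  show ?thesis using g by (auto simp: hom_relations_def)
qed

text \<open>\<open>g\<close> itself need not preserve any operation. Each defect lies in
  \<open>hom_relations\<close>, hence in \<open>I\<close>, and becomes zero in the quotient.\<close>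

lemma algebra_hom_of_relations:
  assumes A: "unital_algebra A" and F: "unital_algebra F" and g: "\<And>a. a \<in> carrier A \<Longrightarrow> g a \<in> carrier F"
    and I: "ideal I F" and rel: "hom_relations A F g \<subseteq> I"
  shows "algebra_hom A (quotient_algebra F I) (\<lambda>a. I +>\<^bsub>F\<^esub> g a)"
proof -
  interpret A: unital_algebra A by fact
  interpret F: unital_algebra F by fact
  let ?Q = "quotient_algebra F I"
  note \<pi> = algebra_homD[OF quotient_algebra_hom(2)[OF F I]]
  note eq = quotient_algebra_eq[OF F I]
  have relI: "t \<in> hom_relations A F g \<Longrightarrow> t \<in> I" for t using rel by blast
  have "I +>\<^bsub>F\<^esub> g (x \<oplus>\<^bsub>A\<^esub> y) = I +>\<^bsub>F\<^esub> (g x \<oplus>\<^bsub>F\<^esub> g y)" if xy: "x \<in> carrier A" "y \<in> carrier A" for x y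
  proof (rule eq)
    show "g (x \<oplus>\<^bsub>A\<^esub> y) \<ominus>\<^bsub>F\<^esub> (g x \<oplus>\<^bsub>F\<^esub> g y) \<in> I"
      by (rule relI) (unfold hom_relations_def, use xy in blast)
  qed (use xy g in auto)
  moreover have "I +>\<^bsub>F\<^esub> g (x \<otimes>\<^bsub>A\<^esub> y) = I +>\<^bsub>F\<^esub> (g x \<otimes>\<^bsub>F\<^esub> g y)" if xy: "x \<in> carrier A" "y \<in> carrier A" for x y
  proof (rule eq)
    show "g (x \<otimes>\<^bsub>A\<^esub> y) \<ominus>\<^bsub>F\<^esub> (g x \<otimes>\<^bsub>F\<^esub> g y) \<in> I"
      by (rule relI) (unfold hom_relations_def, use xy in blast)
  qed (use xy g in auto)
  moreover have "I +>\<^bsub>F\<^esub> g (c \<odot>\<^bsub>A\<^esub> x) = I +>\<^bsub>F\<^esub> (c \<odot>\<^bsub>F\<^esub> g x)" if x: "x \<in> carrier A" for c x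
  proof (rule eq)
    show "g (c \<odot>\<^bsub>A\<^esub> x) \<ominus>\<^bsub>F\<^esub> (c \<odot>\<^bsub>F\<^esub> g x) \<in> I"
      by (rule relI) (unfold hom_relations_def, use x in blast)
  qed (use x g in auto)
  moreover have "I +>\<^bsub>F\<^esub> g \<one>\<^bsub>A\<^esub> = I +>\<^bsub>F\<^esub> \<one>\<^bsub>F\<^esub>"
  proof (rule eq)
    show "g \<one>\<^bsub>A\<^esub> \<ominus>\<^bsub>F\<^esub> \<one>\<^bsub>F\<^esub> \<in> I"
      by (rule relI) (unfold hom_relations_def, blast)
  qed (use g in auto)
  ultimately show ?thesis
    unfolding algebra_hom_def using g by (auto intro!: ring_hom_memI simp: \<pi>)
qed

lemma commutator_space:
  assumes A: "unital_algebra A" and R: "R \<subseteq> carrier A"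
  shows "commutator_space A R \<subseteq> carrier A"
    and "x \<in> R \<Longrightarrow> y \<in> R \<Longrightarrow> x \<otimes>\<^bsub>A\<^esub> y \<ominus>\<^bsub>A\<^esub> y \<otimes>\<^bsub>A\<^esub> x \<in> commutator_space A R"
proof -
  interpret A: unital_algebra A by fact
  let ?S = "{x \<otimes>\<^bsub>A\<^esub> y \<ominus>\<^bsub>A\<^esub> y \<otimes>\<^bsub>A\<^esub> x | x y. x \<in> R \<and> y \<in> R}"
  have S: "?S \<subseteq> carrier A" using R by auto
  show "commutator_space A R \<subseteq> carrier A"
    unfolding commutator_space_def by (rule A.vs.span_is_subset2[OF S])
  show "x \<otimes>\<^bsub>A\<^esub> y \<ominus>\<^bsub>A\<^esub> y \<otimes>\<^bsub>A\<^esub> x \<in> commutator_space A R" if "x \<in> R" "y \<in> R"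
    unfolding commutator_space_def using A.vs.in_own_span[OF S] that by blast
qed

section \<open>From the abstract pair to the free product\<close>

lemma MID_algebraI:
  assumes "\<And>W \<rho>. irreducible_representation R (W :: ('k :: field, 'w) module) \<rho> \<Longrightarrow> edim W \<le> enat m"
  shows "MID_algebra TYPE('w) m R"
  unfolding MID_algebra_def mid_def using assms by (auto intro!: Sup_least)

text \<open>The image of a basis of \<open>A\<close> spans the image of \<open>A\<close>. If
  \<open>\<alpha>\<close> is not injective, the image can only have fewer elements, so the bound by
  the dimension of \<open>A\<close> persists.\<close>

lemma edim_le_dim:
  fixes A :: "('k :: {alg_closed_field, field_char_0}, 'a) module"
  assumes A: "unital_algebra A" "vectorspace.fin_dim class_ring A"
    and \<alpha>: "algebra_hom A Q \<alpha>"
    and pair: "irreducible_pair Q (\<alpha> ` carrier A) SB X W \<rho>"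
  shows "edim W \<le> enat (vectorspace.dim class_ring A)"
proof -
  interpret A: unital_algebra A by fact
  interpret P: irreducible_pair Q "\<alpha> ` carrier A" SB X W \<rho> by fact
  obtain E where E: "finite E" "A.vs.basis E"
    using A.vs.finite_basis_exists[OF A(2)] by blast
  have EA: "E \<subseteq> carrier A" and span: "A.vs.span E = carrier A" using E(2) by (auto simp: A.vs.basis_def)
  have "edim W \<le> enat (card (\<alpha> ` E))"
  proof (rule P.edim_le_card_span)
    fix U assume U: "VectorSpace.subspace class_ring U Q" "\<alpha> ` E \<subseteq> U"
    have "VectorSpace.subspace class_ring {x \<in> carrier A. \<alpha> x \<in> U} A"
      by (rule subspace_vimage[OF \<alpha> A(1) P.unital_algebra_axioms U(1)])
    then have "submodule class_ring {x \<in> carrier A. \<alpha> x \<in> U} A" by (simp add: VectorSpace.subspace_def)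
    then have "A.vs.span E \<subseteq> {x \<in> carrier A. \<alpha> x \<in> U}"
      by (rule A.vs.span_is_subset[rotated]) (use EA U(2) in auto)
    then show "\<alpha> ` carrier A \<subseteq> U" using span by auto
  qed (use E EA in auto)
  also have "\<dots> \<le> enat (card E)" using E(1) by (simp add: card_image_le)
  also have "card E = A.vs.dim" using A.vs.dim_basis[OF E] by simp
  finally show ?thesis .
qed

text \<open>Each of finitely many generators of \<open>A\<close> is a scalar plus an element of
  \<open>Abar\<close>, and the latter is the projection of some element of \<open>V\<close>.
  Genericity enters here, with \<open>f\<close> one of the two projections.\<close>

lemma finite_spanning_projection:
  assumes A: "unital_algebra A" "vectorspace.fin_dim class_ring A" "unit_complement A Abar"
    and V: "f ` V = Abar"
  shows "\<exists>V0\<subseteq>V. finite V0 \<and> (\<forall>U. VectorSpace.subspace class_ring U A \<longrightarrow> insert \<one>\<^bsub>A\<^esub> (f ` V0) \<subseteq> U \<longrightarrow> carrier A \<subseteq> U)"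
proof -
  interpret A: unital_algebra A by fact
  obtain G where G: "finite G" "G \<subseteq> carrier A" "A.vs.span G = carrier A"
    using A(2) unfolding A.vs.fin_dim_def by auto
  have "\<exists>v\<in>V. \<exists>c. g = c \<odot>\<^bsub>A\<^esub> \<one>\<^bsub>A\<^esub> \<oplus>\<^bsub>A\<^esub> f v" if "g \<in> G" for g
  proof -
    have "g \<in> A.vs.submodule_sum (range (\<lambda>c. c \<odot>\<^bsub>A\<^esub> \<one>\<^bsub>A\<^esub>)) Abar"
      using that G(2) A(3) by (auto simp: unit_complement_def)
    then show ?thesis unfolding A.vs.submodule_sum_def using V by auto
  qed
  then obtain s where s: "\<And>g. g \<in> G \<Longrightarrow> s g \<in> V" "\<And>g. g \<in> G \<Longrightarrow> \<exists>c. g = c \<odot>\<^bsub>A\<^esub> \<one>\<^bsub>A\<^esub> \<oplus>\<^bsub>A\<^esub> f (s g)"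
    by metis
  have "carrier A \<subseteq> U" if U: "VectorSpace.subspace class_ring U A" "insert \<one>\<^bsub>A\<^esub> (f ` s ` G) \<subseteq> U" for U
  proof -
    have "g \<in> U" if g: "g \<in> G" for g
    proof -
      obtain c where eq: "g = c \<odot>\<^bsub>A\<^esub> \<one>\<^bsub>A\<^esub> \<oplus>\<^bsub>A\<^esub> f (s g)" using s(2)[OF g] by (elim exE)
      have "f (s g) \<in> U" "\<one>\<^bsub>A\<^esub> \<in> U" using U(2) g by auto
      then have "c \<odot>\<^bsub>A\<^esub> \<one>\<^bsub>A\<^esub> \<oplus>\<^bsub>A\<^esub> f (s g) \<in> U"
        using U(1) unfolding A.subspace_alg_iff by simp
      then show ?thesis by (simp only: eq[symmetric])
    qed
    then have "A.vs.span G \<subseteq> U"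
      using U(1) by (intro A.vs.span_is_subset) (auto simp: VectorSpace.subspace_def)
    with G(3) show ?thesis by simp
  qed
  then show ?thesis using s(1) G(1) by (intro exI[of _ "s ` G"]) auto
qed

theorem corollary8:
  fixes A :: "('k :: {alg_closed_field, field_char_0}, 'a) module"
    and B :: "('k, 'b) module"
    and Abar :: "'a set" and Bbar :: "'b set"
    and V :: "('a \<times> 'b) set" and m :: nat
  assumes "unital_algebra A" and "vectorspace.fin_dim class_ring A"
    and "unital_algebra B" and "vectorspace.fin_dim class_ring B"
    and "unit_complement A Abar" and "unit_complement B Bbar"
    and "m = min (vectorspace.dim class_ring A) (vectorspace.dim class_ring B)"
    and "generic_subspace A B Abar Bbar V"
  shows "MID_algebra TYPE('w) m
           (partial_abelianization (free_product A B) (sum_embed A B ` V))"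
proof (rule MID_algebraI)
  let ?F = "free_algebra_on A B" and ?I = "free_product_ideal A B"
  let ?P = "free_product A B"
  let ?inl = "free_product_inl A B" and ?inr = "free_product_inr A B"
  let ?R = "generated_subalgebra ?P (sum_embed A B ` V)"
  let ?J = "Idl\<^bsub>?P\<^esub> (commutator_space ?P ?R)"
  let ?Q = "partial_abelianization ?P (sum_embed A B ` V)"
  let ?\<pi> = "\<lambda>x. ?J +>\<^bsub>?P\<^esub> x"
  interpret A: unital_algebra A by fact
  interpret B: unital_algebra B by fact
  interpret F: unital_algebra ?F by (rule free_algebra_unital_algebra)
  let ?relA = "hom_relations A ?F (\<lambda>a. free_gen (Inl a))"
  let ?relB = "hom_relations B ?F (\<lambda>b. free_gen (Inr b))"
  have genA: "free_gen (Inl a) \<in> carrier ?F" if "a \<in> carrier A" for a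
    using that by (intro free_gen_closed) auto
  have genB: "free_gen (Inr b) \<in> carrier ?F" if "b \<in> carrier B" for b
    using that by (intro free_gen_closed) auto
  have rels: "?relA \<union> ?relB \<subseteq> carrier ?F"
    using hom_relations_carrier[OF assms(1) F.unital_algebra_axioms genA]
      hom_relations_carrier[OF assms(3) F.unital_algebra_axioms genB] by (rule Un_least)
  have I: "ideal ?I ?F"
    unfolding free_product_ideal_def Let_def by (rule F.genideal_ideal[OF rels])
  have relI: "?relA \<union> ?relB \<subseteq> ?I"
    unfolding free_product_ideal_def Let_def by (rule F.genideal_self[OF rels])
  have P: "unital_algebra ?P" and \<pi>P: "algebra_hom ?F ?P (\<lambda>x. ?I +>\<^bsub>?F\<^esub> x)"
    and surjP: "(\<lambda>x. ?I +>\<^bsub>?F\<^esub> x) ` carrier ?F = carrier ?P"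
    unfolding free_product_def by (rule quotient_algebra_hom[OF F.unital_algebra_axioms I])+
  interpret P: unital_algebra ?P by (rule P)
  have inl: "algebra_hom A ?P ?inl"
    unfolding free_product_def free_product_inl_def
    by (rule algebra_hom_of_relations[OF assms(1) F.unital_algebra_axioms genA I]) (use relI in auto)
  have inr: "algebra_hom B ?P ?inr"
    unfolding free_product_def free_product_inr_def
    by (rule algebra_hom_of_relations[OF assms(3) F.unital_algebra_axioms genB I]) (use relI in auto)
  have Vfst: "fst ` V = Abar" and Vsnd: "snd ` V = Bbar"
    using assms(8) by (auto simp: generic_subspace_def)
  have "Abar \<subseteq> carrier A" "Bbar \<subseteq> carrier B"
    using assms(5,6) A.subspace_alg_iff B.subspace_alg_iff by (auto simp: unit_complement_def)
  then have VA: "fst v \<in> carrier A" and VB: "snd v \<in> carrier B" if "v \<in> V" for v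
    using that Vfst Vsnd by blast+
  have embV: "sum_embed A B ` V \<subseteq> carrier ?P"
    using algebra_homD(1)[OF inl VA] algebra_homD(1)[OF inr VB] by (auto simp: sum_embed_def)
  have R: "?R \<subseteq> carrier ?P" and VR: "sum_embed A B ` V \<subseteq> ?R"
    using P.generated_subalgebra[OF embV] P.subalgebraD(1) by blast+
  note comm_space = commutator_space[OF P R]
  have J: "ideal ?J ?P" by (rule P.genideal_ideal[OF comm_space(1)])
  have commJ: "x \<otimes>\<^bsub>?P\<^esub> y \<ominus>\<^bsub>?P\<^esub> y \<otimes>\<^bsub>?P\<^esub> x \<in> ?J" if "x \<in> ?R" "y \<in> ?R" for x y
    using P.genideal_self[OF comm_space(1)] comm_space(2)[OF that] by blast
  have Q: "unital_algebra ?Q" and \<pi>: "algebra_hom ?P ?Q ?\<pi>" and surjQ: "?\<pi> ` carrier ?P = carrier ?Q"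
    unfolding partial_abelianization_def by (rule quotient_algebra_hom[OF P J])+
  interpret Q: unital_algebra ?Q by (rule Q)
  define \<alpha> where "\<alpha> a = ?\<pi> (?inl a)" for a
  define \<beta> where "\<beta> b = ?\<pi> (?inr b)" for b
  have \<alpha>: "algebra_hom A ?Q \<alpha>" unfolding \<alpha>_def by (rule algebra_hom_comp[OF inl \<pi>])
  have \<beta>: "algebra_hom B ?Q \<beta>" unfolding \<beta>_def by (rule algebra_hom_comp[OF inr \<pi>])
  have \<alpha>\<beta>: "\<alpha> (fst v) \<oplus>\<^bsub>?Q\<^esub> \<beta> (snd v) = ?\<pi> (sum_embed A B v)" if v: "v \<in> V" for v
  proof -
    have "sum_embed A B v = ?inl (fst v) \<oplus>\<^bsub>?P\<^esub> ?inr (snd v)" by (rule sum_embed_def)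
    then show ?thesis
      using algebra_homD(3)[OF \<pi> algebra_homD(1)[OF inl VA[OF v]] algebra_homD(1)[OF inr VB[OF v]]]
      by (simp only: \<alpha>_def \<beta>_def)
  qed
  \<comment> \<open>Both sums are images of elements of \<open>?R\<close>, whose commutator lies in
    the ideal \<open>?J\<close> that is divided out.\<close>
  have comm: "(\<alpha> (fst v) \<oplus>\<^bsub>?Q\<^esub> \<beta> (snd v)) \<otimes>\<^bsub>?Q\<^esub> (\<alpha> (fst w) \<oplus>\<^bsub>?Q\<^esub> \<beta> (snd w)) =
      (\<alpha> (fst w) \<oplus>\<^bsub>?Q\<^esub> \<beta> (snd w)) \<otimes>\<^bsub>?Q\<^esub> (\<alpha> (fst v) \<oplus>\<^bsub>?Q\<^esub> \<beta> (snd v))" if v: "v \<in> V" and w: "w \<in> V" for v w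
  proof -
    let ?x = "sum_embed A B v" and ?y = "sum_embed A B w"
    have xy: "?x \<in> ?R" "?y \<in> ?R" using VR v w by auto
    then have c: "?x \<in> carrier ?P" "?y \<in> carrier ?P" using R by auto
    have "?\<pi> (?x \<otimes>\<^bsub>?P\<^esub> ?y) = ?\<pi> (?y \<otimes>\<^bsub>?P\<^esub> ?x)"
      by (rule quotient_algebra_eq[OF P J _ _ commJ[OF xy]]) (use c in auto)
    then show ?thesis
      unfolding \<alpha>\<beta>[OF v] \<alpha>\<beta>[OF w] algebra_homD(4)[OF \<pi> c] algebra_homD(4)[OF \<pi> c(2) c(1)] .
  qed
  \<comment> \<open>\<open>T\<close> is pulled back along the composite surjection from the free
    algebra. The preimage is a subalgebra that contains all letters, hence is everything.\<close>
  have gen: "carrier ?Q \<subseteq> T" if T: "subalgebra_of T ?Q" "\<alpha> ` carrier A \<union> \<beta> ` carrier B \<subseteq> T" for T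
  proof -
    let ?q = "\<lambda>x. ?\<pi> (?I +>\<^bsub>?F\<^esub> x)"
    have q: "algebra_hom ?F ?Q ?q" by (rule algebra_hom_comp[OF \<pi>P \<pi>])
    have "carrier ?F \<subseteq> {x \<in> carrier ?F. ?q x \<in> T}"
    proof (rule free_algebra_generated[OF subalgebra_vimage[OF q F.unital_algebra_axioms Q T(1)]], rule image_subsetI)
      fix x assume x: "x \<in> Sum_Type.Plus (carrier A) (carrier B)"
      have "?q (free_gen x) \<in> T"
      proof (cases x)
        case (Inl a)
        then have "\<alpha> a \<in> T" using x T(2) by auto
        then show ?thesis by (simp add: \<alpha>_def free_product_inl_def Inl)
      next
        case (Inr b)
        then have "\<beta> b \<in> T" using x T(2) by auto
        then show ?thesis by (simp add: \<beta>_def free_product_inr_def Inr)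
      qed
      then show "free_gen x \<in> {x \<in> carrier ?F. ?q x \<in> T}" using free_gen_closed[OF x] by simp
    qed
    then show ?thesis unfolding surjQ[symmetric] surjP[symmetric] by blast
  qed
  obtain VA0 where VA0: "VA0 \<subseteq> V" "finite VA0"
    "\<And>U. VectorSpace.subspace class_ring U A \<Longrightarrow> insert \<one>\<^bsub>A\<^esub> (fst ` VA0) \<subseteq> U \<Longrightarrow> carrier A \<subseteq> U"
    using finite_spanning_projection[OF assms(1,2,5) Vfst] by blast
  obtain VB0 where VB0: "VB0 \<subseteq> V" "finite VB0"
    "\<And>U. VectorSpace.subspace class_ring U B \<Longrightarrow> insert \<one>\<^bsub>B\<^esub> (snd ` VB0) \<subseteq> U \<Longrightarrow> carrier B \<subseteq> U"
    using finite_spanning_projection[OF assms(3,4,6) Vsnd] by blast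
  \<comment> \<open>The same finite set of sums must serve both projections, so the elements chosen
    for \<open>A\<close> and those chosen for \<open>B\<close> are joined.\<close>
  define X where "X = (\<lambda>v. (\<alpha> (fst v), \<beta> (snd v))) ` (VA0 \<union> VB0)"
  fix W :: "('k, 'w) module" and \<rho>
  assume irr: "irreducible_representation ?Q W \<rho>"
  have pair: "irreducible_pair ?Q (\<alpha> ` carrier A) (\<beta> ` carrier B) X W \<rho>"
  proof (intro irreducible_pair.intro irreducible_pair_axioms.intro Q irr gen)
    show "subalgebra_of (\<alpha> ` carrier A) ?Q" by (rule subalgebra_image[OF \<alpha> assms(1) Q])
    show "subalgebra_of (\<beta> ` carrier B) ?Q" by (rule subalgebra_image[OF \<beta> assms(3) Q])
    show "finite X" using VA0(2) VB0(2) by (simp add: X_def)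
    have V0: "VA0 \<union> VB0 \<subseteq> V" using VA0(1) VB0(1) by simp
    show "X \<subseteq> \<alpha> ` carrier A \<times> \<beta> ` carrier B"
      unfolding X_def using V0 VA VB by (intro image_subsetI) auto
    show "(fst p \<oplus>\<^bsub>?Q\<^esub> snd p) \<otimes>\<^bsub>?Q\<^esub> (fst q \<oplus>\<^bsub>?Q\<^esub> snd q) = (fst q \<oplus>\<^bsub>?Q\<^esub> snd q) \<otimes>\<^bsub>?Q\<^esub> (fst p \<oplus>\<^bsub>?Q\<^esub> snd p)"
      if p: "p \<in> X" and q: "q \<in> X" for p q
    proof -
      from p q obtain v w where "v \<in> V" "w \<in> V" "p = (\<alpha> (fst v), \<beta> (snd v))" "q = (\<alpha> (fst w), \<beta> (snd w))"
        unfolding X_def using V0 by blast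
      then show ?thesis using comm[of v w] by simp
    qed
    show "\<alpha> ` carrier A \<subseteq> U" if U: "VectorSpace.subspace class_ring U ?Q" "insert \<one>\<^bsub>?Q\<^esub> (fst ` X) \<subseteq> U" for U
    proof -
      have "carrier A \<subseteq> {a \<in> carrier A. \<alpha> a \<in> U}"
      proof (rule VA0(3)[OF subspace_vimage[OF \<alpha> assms(1) Q U(1)]])
        have "\<alpha> (fst v) \<in> U" if "v \<in> VA0" for v
        proof -
          have "(\<alpha> (fst v), \<beta> (snd v)) \<in> X" using that by (auto simp: X_def)
          then show ?thesis using U(2) by force
        qed
        then show "insert \<one>\<^bsub>A\<^esub> (fst ` VA0) \<subseteq> {a \<in> carrier A. \<alpha> a \<in> U}"
          using U(2) algebra_homD(2)[OF \<alpha>] VA VA0(1) by auto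
      qed
      then show ?thesis by auto
    qed
    show "\<beta> ` carrier B \<subseteq> U" if U: "VectorSpace.subspace class_ring U ?Q" "insert \<one>\<^bsub>?Q\<^esub> (snd ` X) \<subseteq> U" for U
    proof -
      have "carrier B \<subseteq> {b \<in> carrier B. \<beta> b \<in> U}"
      proof (rule VB0(3)[OF subspace_vimage[OF \<beta> assms(3) Q U(1)]])
        have "\<beta> (snd v) \<in> U" if "v \<in> VB0" for v
        proof -
          have "(\<alpha> (fst v), \<beta> (snd v)) \<in> X" using that by (auto simp: X_def)
          then show ?thesis using U(2) by force
        qed
        then show "insert \<one>\<^bsub>B\<^esub> (snd ` VB0) \<subseteq> {b \<in> carrier B. \<beta> b \<in> U}"
          using U(2) algebra_homD(2)[OF \<beta>] VB VB0(1) by auto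
      qed
      then show ?thesis by auto
    qed
  qed
  have "edim W \<le> enat (vectorspace.dim class_ring A)"
    by (rule edim_le_dim[OF assms(1,2) \<alpha> pair])
  \<comment> \<open>The same pair with the roles of \<open>A\<close> and \<open>B\<close> exchanged
    gives the second bound.\<close>
  moreover have "edim W \<le> enat (vectorspace.dim class_ring B)"
    by (rule edim_le_dim[OF assms(3,4) \<beta> irreducible_pair.swap[OF pair]])
  ultimately show "edim W \<le> enat m" unfolding assms(7) by (simp add: min_def)
qed

end
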